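(* A triangle-type planar circle packing on the Euclidean plane is determined up to isometry by the size of its boundary circles, in the sense of keeping the contact graph unchanged. That is, let $P_1,P_2$ be triangle-type planar circle packings in the Euclidean plane with the same contact graph, identified with the nerve of the same bordered triangulated surface $(S,T)$. If for every boundary vertex $v$ of $(S,T)$ the circles of $P_1$ and $P_2$ corresponding to $v$ have the same radius, then there is an isometry of the Euclidean plane carrying, for every vertex $v$ of $T$, the circle of $P_1$ corresponding to $v$ to the circle of $P_2$ corresponding to $v$.
   Context: A planar circle packing is a connected collection of circles in the Euclidean plane whose interiors are disjoint. Its contact graph is the graph having a vertex for each circle and an edge for every pair of circles that are tangent. A bordered triangulated surface $(S,T)$ is a connected compact surface $S$ with non-empty boundary together with a finite triangulation $T$. Its nerve is the graph formed by the vertices and edges of $T$. A vertex of $T$ is a boundary vertex if it belongs to the boundary of $S$. A planar circle packing is triangle-type if there exists a bordered triangulated surface whose nerve is isomorphic to the contact graph of the packing. A circle of the packing is a boundary circle if it corresponds to a boundary vertex of the bordered triangulated surface under this isomorphism.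
   Formalization: The formal theorem also assumes, for each of P_1 and P_2, that the triangles spanned by the circle centres of distinct faces of T have disjoint interiors; without this the claim is false, since two triangles sharing an edge may be either unfolded or folded over each other. *)

theory Defs
  imports "HOL-Analysis.Analysis"
begin

section \<open>Planar circle packings\<close>

text \<open>The Euclidean plane is the type \<^typ>\<open>complex\<close> with its usual distance. A circle is
  recorded as the pair of its centre and its radius.\<close>

type_synonym circle = "complex \<times> real"

abbreviation centre :: "circle \<Rightarrow> complex" where "centre \<equiv> fst"
abbreviation radius :: "circle \<Rightarrow> real" where "radius \<equiv> snd"

definition circle_points :: "circle \<Rightarrow> complex set" where
  "circle_points C = sphere (centre C) (radius C)"

definition circle_interior :: "circle \<Rightarrow> complex set" where
  "circle_interior C = ball (centre C) (radius C)"

definition tangent :: "circle \<Rightarrow> circle \<Rightarrow> bool" where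
  "tangent C D \<longleftrightarrow> (\<exists>p. circle_points C \<inter> circle_points D = {p})"

definition planar_circle_packing :: "circle set \<Rightarrow> bool" where
  "planar_circle_packing P \<longleftrightarrow>
     (\<forall>C\<in>P. radius C > 0) \<and>
     (\<forall>C\<in>P. \<forall>D\<in>P. C \<noteq> D \<longrightarrow> circle_interior C \<inter> circle_interior D = {}) \<and>
     connected (\<Union>C\<in>P. circle_points C)"

text \<open>Simple graphs are pairs of a vertex set and a set of two-element edges.\<close>

type_synonym 'v graph = "'v set \<times> 'v set set"

definition contact_graph :: "circle set \<Rightarrow> circle graph" where
  "contact_graph P = (P, {{C, D} |C D. C \<in> P \<and> D \<in> P \<and> C \<noteq> D \<and> tangent C D})"

definition graph_isomorphism :: "'v graph \<Rightarrow> 'w graph \<Rightarrow> ('v \<Rightarrow> 'w) \<Rightarrow> bool" where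
  "graph_isomorphism G H \<phi> \<longleftrightarrow>
     bij_betw \<phi> (fst G) (fst H) \<and>
     (\<forall>u\<in>fst G. \<forall>v\<in>fst G. {u, v} \<in> snd G \<longleftrightarrow> {\<phi> u, \<phi> v} \<in> snd H)"


section \<open>Bordered triangulated surfaces\<close>

definition half_plane_chart ::
    "'a topology \<Rightarrow> 'a set \<Rightarrow> ('a \<Rightarrow> complex) \<Rightarrow> bool" where
  "half_plane_chart S U \<psi> \<longleftrightarrow>
     openin S U \<and>
     (\<exists>W. openin (top_of_set {z. Im z \<ge> 0}) W \<and>
          homeomorphic_map (subtopology S U) (top_of_set W) \<psi>)"

definition surface :: "'a topology \<Rightarrow> bool" where
  "surface S \<longleftrightarrow>
     Hausdorff_space S \<and> second_countable S \<and>
     (\<forall>p\<in>topspace S. \<exists>U \<psi>. half_plane_chart S U \<psi> \<and> p \<in> U)"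

definition surface_boundary :: "'a topology \<Rightarrow> 'a set" where
  "surface_boundary S =
     {p \<in> topspace S. \<exists>U \<psi>. half_plane_chart S U \<psi> \<and> p \<in> U \<and> Im (\<psi> p) = 0}"

text \<open>A finite triangulation of \<open>S\<close> is a (finite, by definition) geometric simplicial complex
  \<open>K\<close> in some Euclidean space together with a homeomorphism \<open>h\<close> from its
  polyhedron onto \<open>S\<close>. A triangulation in the looser sense of triangles glued along edges gives
  nothing new when its nerve is a contact graph: contact graphs have no loops or multiple edges,
  and the only such gluing that is not a simplicial complex is then two triangles glued along
  their whole boundary, which is a sphere and has no border.\<close>

definition bordered_triangulated_surface ::
    "'a topology \<Rightarrow> 'n::euclidean_space set set \<Rightarrow> ('n \<Rightarrow> 'a) \<Rightarrow> bool" where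
  "bordered_triangulated_surface S K h \<longleftrightarrow>
     surface S \<and> compact_space S \<and> connected_space S \<and> surface_boundary S \<noteq> {} \<and>
     simplicial_complex K \<and> homeomorphic_map (top_of_set (\<Union>K)) S h"

definition triangulation_simplices ::
    "nat \<Rightarrow> 'n::euclidean_space set set \<Rightarrow> ('n \<Rightarrow> 'a) \<Rightarrow> 'a set set" where
  "triangulation_simplices k K h =
     {h ` C |C. \<not> affine_dependent C \<and> card C = k + 1 \<and> convex hull C \<in> K}"

definition triangulation_vertices ::
    "'n::euclidean_space set set \<Rightarrow> ('n \<Rightarrow> 'a) \<Rightarrow> 'a set" where
  "triangulation_vertices K h = {v. {v} \<in> triangulation_simplices 0 K h}"

definition nerve :: "'n::euclidean_space set set \<Rightarrow> ('n \<Rightarrow> 'a) \<Rightarrow> 'a graph" where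
  "nerve K h = (triangulation_vertices K h, triangulation_simplices 1 K h)"

definition boundary_vertices ::
    "'a topology \<Rightarrow> 'n::euclidean_space set set \<Rightarrow> ('n \<Rightarrow> 'a) \<Rightarrow> 'a set" where
  "boundary_vertices S K h = triangulation_vertices K h \<inter> surface_boundary S"


section \<open>Triangle-type packings\<close>

text \<open>The contact graph of a planar packing is a graph drawn in the plane (vertices at the centres,
  edges as straight segments), and identifying it with the nerve of \<open>(S, T)\<close> is read as
  realising \<open>(S, T)\<close> in the plane: besides the isomorphism of graphs, the triangles spanned
  by the centres of distinct faces of \<open>T\<close> do not overlap. This is the usual meaning of a
  packing with a prescribed triangulation. An abstract isomorphism of graphs alone would not determine the
  packing, since a face could be folded onto its neighbour. For instance, let circles of radius 1
  have centres \<open>-1\<close> and \<open>1\<close>, and add circles of radius 1/24 with centre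
  \<open>(7/24) i\<close> and of radius 2/3 with centre \<open>(4/3) i\<close> or \<open>-(4/3) i\<close>.
  Either choice is a packing with contact graph two triangles sharing an edge, the
  nerve of a disc all of whose vertices lie on the boundary, but the two packings
  are not isometric.\<close>

definition faces_do_not_overlap ::
    "'n::euclidean_space set set \<Rightarrow> ('n \<Rightarrow> 'a) \<Rightarrow> ('a \<Rightarrow> circle) \<Rightarrow> bool" where
  "faces_do_not_overlap K h \<phi> \<longleftrightarrow>
     (\<forall>s\<in>triangulation_simplices 2 K h. \<forall>t\<in>triangulation_simplices 2 K h. s \<noteq> t \<longrightarrow>
        interior (convex hull ((centre \<circ> \<phi>) ` s)) \<inter>
        interior (convex hull ((centre \<circ> \<phi>) ` t)) = {})"

definition triangle_type_packing ::
    "'n::euclidean_space set set \<Rightarrow> ('n \<Rightarrow> 'a) \<Rightarrow> circle set \<Rightarrow> ('a \<Rightarrow> circle) \<Rightarrow> bool" where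
  "triangle_type_packing K h P \<phi> \<longleftrightarrow>
     planar_circle_packing P \<and>
     graph_isomorphism (nerve K h) (contact_graph P) \<phi> \<and>
     faces_do_not_overlap K h \<phi>"

end

theory Submission
  imports Defs
begin

text \<open>
  The radii are determined by a discrete maximum principle, and the centres are then found by
  laying out the triangles one after another.

  In a packing, the centres of the circles of a face span a triangle whose side lengths are the
  sums of two radii, so each of its angles is a function of the radii
  (\<open>corner_angle_eq_radius_angle\<close>). At a vertex off the border every edge belongs to two
  faces. These do not overlap, so they lie on opposite sides of the edge, and hence
  the union of the corners at that vertex is both open and closed away from the apex: the corners
  fill the whole plane without overlap, and their angles add up to \<open>2 * pi\<close> (\<open>angle_sum\<close>). For
  two packings of the same triangulation, with radii \<open>r\<close> and \<open>s\<close>, let \<open>v\<close> be a vertex where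
  \<open>r v / s v\<close> is maximal, and suppose that \<open>v\<close> is off the border. The angle of a face at \<open>v\<close> increases with the
  ratio of a neighbouring radius to the radius at \<open>v\<close>, so no angle at \<open>v\<close> is larger for \<open>r\<close> than
  for \<open>s\<close>; as both sums are \<open>2 * pi\<close>, the angles agree and the neighbours of \<open>v\<close> attain the
  maximum as well. If the maximum exceeded \<open>1\<close>, all the vertices attaining it would thus be off
  the border and would form a set closed under taking neighbours. This is absurd: the rightmost
  centre of such a set would have no neighbour to its right, so its corners could not fill the
  plane (\<open>surrounded_not_extreme\<close>). Therefore \<open>r \<le> s\<close>, and by symmetry \<open>r = s\<close>
  (\<open>radius_maximum_principle\<close>).

  Once the radii agree, a rigid motion matches one face of the two packings. If it matches a
  face, it matches every face that shares an edge with it, because the third vertex is determined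
  by its distances to the ends of the edge and by the side on which it lies. Every face is reached
  in this way (\<open>layout_determined_by_radii\<close>).

  Two facts about the surface are needed, and both come from its charts. If an edge at a vertex
  off the border belonged to a single face, the chart would put a disc neighbourhood inside a triangle around a
  point of its boundary, against invariance of domain (\<open>second_triangle\<close>). And a surface stays
  connected when its finitely many vertices are removed; since faces without a common edge meet
  in vertices only, the faces cannot split into two classes with no adjacency between them
  (\<open>triangles_edge_connected\<close>).
\<close>

section \<open>Corners in the plane\<close>

text \<open>The determinant of the matrix with columns \<open>a\<close> and \<open>b\<close>: its sign tells on which side of the
  line through \<open>0\<close> and \<open>a\<close> the point \<open>b\<close> lies.\<close>

definition wedge :: "complex \<Rightarrow> complex \<Rightarrow> real" where
  "wedge a b = Re a * Im b - Im a * Re b"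

lemma wedge_swap: "wedge a b = - wedge b a"
  by (simp add: wedge_def)

lemma wedge_add_right: "wedge a (b + c) = wedge a b + wedge a c"
  by (simp add: wedge_def algebra_simps)

lemma wedge_add_left: "wedge (a + b) c = wedge a c + wedge b c"
  by (simp add: wedge_def algebra_simps)

lemma wedge_scaleR [simp]:
  "wedge (x *\<^sub>R a) b = x * wedge a b" "wedge a (x *\<^sub>R b) = x * wedge a b"
  by (simp_all add: wedge_def algebra_simps)

lemma wedge_self [simp]: "wedge a a = 0"
  by (simp add: wedge_def)

lemma continuous_on_wedge [continuous_intros]:
  assumes "continuous_on A f" "continuous_on A g"
  shows "continuous_on A (\<lambda>x. wedge (f x) (g x))"
  unfolding wedge_def by (intro continuous_intros assms)

lemma wedge_cramer:
  assumes "wedge a b \<noteq> 0"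
  shows "z = (wedge z b / wedge a b) *\<^sub>R a + (wedge a z / wedge a b) *\<^sub>R b"
proof -
  have "wedge a b *\<^sub>R z = wedge z b *\<^sub>R a + wedge a z *\<^sub>R b"
    by (simp add: wedge_def complex_eq_iff algebra_simps)
  then have "(1 / wedge a b) *\<^sub>R (wedge a b *\<^sub>R z)
      = (1 / wedge a b) *\<^sub>R (wedge z b *\<^sub>R a + wedge a z *\<^sub>R b)" by simp
  then show ?thesis using assms by (simp add: scaleR_add_right)
qed

lemma wedge_inner_squares: "(wedge a b)\<^sup>2 + (a \<bullet> b)\<^sup>2 = (norm a)\<^sup>2 * (norm b)\<^sup>2"
  unfolding wedge_def inner_complex_def cmod_power2 by algebra

text \<open>For linearly independent \<open>a\<close> and \<open>b\<close> this is the convex cone that they span. By Cramer's rule the two products have the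
  signs of the coordinates of \<open>z\<close> in the basis \<open>a, b\<close>, whichever the orientation of the basis;
  in this form closedness and openness are evident.\<close>

definition corner :: "complex \<Rightarrow> complex \<Rightarrow> complex set" where
  "corner a b = {z. wedge a z * wedge a b \<ge> 0 \<and> wedge z b * wedge a b \<ge> 0}"

definition open_corner :: "complex \<Rightarrow> complex \<Rightarrow> complex set" where
  "open_corner a b = {z. wedge a z * wedge a b > 0 \<and> wedge z b * wedge a b > 0}"

lemma corner_swap: "corner b a = corner a b" "open_corner b a = open_corner a b"
  unfolding corner_def open_corner_def wedge_def by (auto simp: algebra_simps)

lemma open_corner_subset_corner: "open_corner a b \<subseteq> corner a b"
  unfolding corner_def open_corner_def by auto

lemma closed_corner: "closed (corner a b)"
  unfolding corner_def by (intro closed_Collect_conj closed_Collect_le continuous_intros)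

lemma open_open_corner: "open (open_corner a b)"
  unfolding open_corner_def by (intro open_Collect_conj open_Collect_less continuous_intros)

text \<open>A triangle looks like its corner near the apex \<open>c\<close>, so overlapping corners
  give overlapping triangles.\<close>

lemma open_corner_meets_triangle:
  assumes "z \<in> open_corner (a - c) (b - c)"
  obtains \<delta> where "\<delta> > 0" "\<And>\<epsilon>. 0 < \<epsilon> \<Longrightarrow> \<epsilon> < \<delta> \<Longrightarrow> c + \<epsilon> *\<^sub>R z \<in> interior (convex hull {c, a, b})"
proof -
  define a' b' d where "a' = a - c" "b' = b - c" "d = wedge a' b'"
  note defs = this
  have d0: "d \<noteq> 0" using assms by (auto simp: open_corner_def defs)
  define U where "U = {w. wedge (w - c) b' / d > 0 \<and> wedge a' (w - c) / d > 0
                          \<and> wedge (w - c) b' / d + wedge a' (w - c) / d < 1}"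
  have "open U" unfolding U_def
    by (intro open_Collect_conj open_Collect_less continuous_intros) (use d0 in auto)
  moreover have "U \<subseteq> convex hull {c, a, b}"
  proof
    fix w assume w: "w \<in> U"
    define s u where "s = wedge (w - c) b' / d" "u = wedge a' (w - c) / d"
    have "w - c = s *\<^sub>R a' + u *\<^sub>R b'"
      using wedge_cramer[of a' b' "w - c"] d0 by (simp add: defs s_u_def)
    then have "w = (1 - s - u) *\<^sub>R c + s *\<^sub>R a + u *\<^sub>R b"
      by (simp add: defs algebra_simps)
    moreover have "s > 0" "u > 0" "s + u < 1" using w by (auto simp: U_def s_u_def)
    ultimately show "w \<in> convex hull {c, a, b}"
      unfolding convex_hull_3
      by (intro CollectI exI[of _ "1 - s - u"] exI[of _ s] exI[of _ u]) auto
  qed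
  ultimately have U: "U \<subseteq> interior (convex hull {c, a, b})" by (rule interior_maximal[rotated])
  define s u where "s = wedge z b' / d" "u = wedge a' z / d"
  have su: "s > 0" "u > 0"
    using assms by (auto simp: open_corner_def defs s_u_def zero_less_mult_iff zero_less_divide_iff)
  show thesis
  proof (rule that)
    \<comment> \<open>The ray from \<open>c\<close> in the direction \<open>z\<close> leaves the triangle at the parameter \<open>1 / (s + u)\<close>.\<close>
    show "1 / (s + u) > 0" using su by simp
    fix \<epsilon> :: real assume e: "0 < \<epsilon>" "\<epsilon> < 1 / (s + u)"
    have "\<epsilon> * s > 0" "\<epsilon> * u > 0" "\<epsilon> * s + \<epsilon> * u < 1" using e su by (auto simp: field_simps)
    then have "c + \<epsilon> *\<^sub>R z \<in> U" by (simp add: U_def s_u_def)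
    then show "c + \<epsilon> *\<^sub>R z \<in> interior (convex hull {c, a, b})" using U by blast
  qed
qed

text \<open>The points \<open>a + x *\<^sub>R b\<close> with small \<open>x > 0\<close> lie in both corners.\<close>

lemma same_side_open_corners_meet:
  assumes "wedge a b * wedge a b' > 0"
  shows "open_corner a b \<inter> open_corner a b' \<noteq> {}"
proof -
  have "((\<lambda>x. wedge (a + x *\<^sub>R b) b' * wedge a b') \<longlongrightarrow> wedge (a + 0 *\<^sub>R b) b' * wedge a b') (at_right 0)"
    unfolding wedge_def by (intro tendsto_intros)
  moreover have "wedge (a + 0 *\<^sub>R b) b' * wedge a b' > 0"
  proof -
    have "wedge a b' \<noteq> 0" using assms by auto
    then have "wedge a b' * wedge a b' > 0" using not_real_square_gt_zero by blast
    then show ?thesis by simp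
  qed
  ultimately have "\<forall>\<^sub>F x in at_right 0. wedge (a + x *\<^sub>R b) b' * wedge a b' > 0"
    by (rule order_tendstoD)
  moreover have "\<forall>\<^sub>F x in at_right (0::real). x > 0" by (rule eventually_at_right_less)
  ultimately have "\<forall>\<^sub>F x in at_right 0. x > 0 \<and> wedge (a + x *\<^sub>R b) b' * wedge a b' > 0"
    by eventually_elim auto
  then obtain x :: real where x: "x > 0" "wedge (a + x *\<^sub>R b) b' * wedge a b' > 0"
    using eventually_happens'[OF trivial_limit_at_right_real] by blast
  have "wedge a b * wedge a b > 0" using assms by (auto simp: zero_less_mult_iff)
  moreover have "x * (wedge a b * wedge a b') > 0" using assms x by simp
  ultimately have "a + x *\<^sub>R b \<in> open_corner a b \<inter> open_corner a b'"
    using x by (simp add: open_corner_def wedge_add_left wedge_add_right mult.assoc)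
  then show ?thesis by blast
qed

section \<open>The angular size of a corner\<close>

definition corner_angle :: "complex \<Rightarrow> complex \<Rightarrow> real" where
  "corner_angle a b = arccos ((a \<bullet> b) / (norm a * norm b))"

text \<open>Angles are measured by the length of the set of directions that a cone contains. This turns
  the additivity of angles into the additivity of Lebesgue measure.\<close>

abbreviation directions :: "complex set \<Rightarrow> real set" where
  "directions A \<equiv> {t \<in> {0..<2*pi}. cis t \<in> A}"

lemma wedge_polar: "wedge (x *\<^sub>R cis s) (y *\<^sub>R cis t) = x * y * sin (t - s)"
  by (simp add: wedge_def sin_diff algebra_simps)

lemma inner_polar: "(x *\<^sub>R cis s) \<bullet> (y *\<^sub>R cis t) = x * y * cos (t - s)"
  by (simp add: inner_complex_def cos_diff algebra_simps)

lemma directions_measurable: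
  assumes "A \<in> sets borel"
  shows "directions A \<in> fmeasurable lborel"
proof -
  have "directions A = {0..<2*pi} \<inter> (cis -` A \<inter> space borel)" by auto
  also have "\<dots> \<in> sets lborel"
  proof -
    have "cis \<in> borel_measurable borel"
      by (intro borel_measurable_continuous_onI continuous_intros)
    then have "cis -` A \<inter> space borel \<in> sets borel" using assms measurable_sets by blast
    then show ?thesis by (intro sets.Int) simp_all
  qed
  finally have *: "directions A \<in> sets lborel" .
  have "emeasure lborel (directions A) \<le> emeasure lborel {0..2*pi}"
    by (intro emeasure_mono) auto
  then show ?thesis using * by (intro fmeasurableI) (auto simp: le_less_trans)
qed

lemma sin_neg_left: "- pi < x \<Longrightarrow> x < 0 \<Longrightarrow> sin x < 0"
  using sin_gt_zero[of "-x"] by simp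

text \<open>Up to its ends, the set of directions is an arc of length \<open>corner_angle a b\<close>, which
  may run across the direction \<open>0\<close>. The inequalities are stated in the two directions in which
  they are used: open corners that are disjoint, closed corners that cover.\<close>

lemma positively_oriented_corner_measure:
  assumes "wedge a b > 0"
  shows "corner_angle a b \<le> measure lborel (directions (open_corner a b))"
    and "measure lborel (directions (corner a b)) \<le> corner_angle a b"
proof -
  have ab0: "a \<noteq> 0" "b \<noteq> 0" using assms by (auto simp: wedge_def)
  define x y where "x = norm a" "y = norm b"
  have xy: "x > 0" "y > 0" using ab0 by (auto simp: x_y_def)
  have polar: "z = norm z *\<^sub>R cis (Arg z)" for z
    by (simp only: scaleR_conv_of_real rcis_def[symmetric] rcis_cmod_Arg)
  have "\<exists>\<alpha>. 0 \<le> \<alpha> \<and> \<alpha> < 2*pi \<and> cis \<alpha> = cis (Arg a)"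
  proof (cases "Arg a \<ge> 0")
    case True
    then show ?thesis using Arg_bounded[of a] by (intro exI[of _ "Arg a"]) auto
  next
    case False
    then show ?thesis using Arg_bounded[of a]
      by (intro exI[of _ "Arg a + 2*pi"]) (auto simp: complex_eq_iff)
  qed
  then obtain \<alpha> where \<alpha>: "0 \<le> \<alpha>" "\<alpha> < 2*pi" "cis \<alpha> = cis (Arg a)" by blast
  have a: "a = x *\<^sub>R cis \<alpha>" unfolding x_y_def \<alpha>(3) by (rule polar)
  define \<theta> where "\<theta> = Arg (b / a)"
  have b: "b = y *\<^sub>R cis (\<alpha> + \<theta>)"
  proof -
    have q: "b / a = (y / x) *\<^sub>R cis \<theta>"
      using polar[of "b / a"] unfolding \<theta>_def x_y_def norm_divide .
    have "b = ((y / x) *\<^sub>R cis \<theta>) * a"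
      by (rule nonzero_divide_eq_eq[OF ab0(1), THEN iffD1, OF q])
    also have "\<dots> = ((y / x) *\<^sub>R cis \<theta>) * (x *\<^sub>R cis \<alpha>)" by (simp only: a[symmetric])
    also have "\<dots> = y *\<^sub>R cis (\<alpha> + \<theta>)" using xy by (simp add: cis_mult add.commute)
    finally show ?thesis .
  qed
  have w: "wedge a b = x * y * sin \<theta>" by (subst b, subst a, subst wedge_polar) simp
  have sp: "sin \<theta> > 0"
    using xy by (rule zero_less_mult_pos[of "x * y" "sin \<theta>", OF assms[unfolded w] mult_pos_pos])
  have \<theta>: "0 < \<theta>" "\<theta> < pi"
  proof -
    have bd: "\<theta> \<le> pi" "-pi < \<theta>" using Arg_bounded by (auto simp: \<theta>_def)
    have "\<theta> \<noteq> 0" "\<theta> \<noteq> pi" using sp by auto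
    moreover have "\<not> \<theta> < 0" using sp sin_neg_left[of \<theta>] bd by linarith
    ultimately show "0 < \<theta>" "\<theta> < pi" using bd by linarith+
  qed
  have angle: "corner_angle a b = \<theta>"
  proof -
    have "a \<bullet> b = x * y * cos \<theta>" by (subst b, subst a, subst inner_polar) simp
    then show ?thesis using xy \<theta> by (simp add: corner_angle_def arccos_cos flip: x_y_def)
  qed
  have wedges: "wedge a (cis t) = x * sin (t - \<alpha>)" "wedge (cis t) b = y * sin (\<alpha> + \<theta> - t)" for t
    using wedge_polar[of 1 \<alpha> 1 t] wedge_polar[of 1 t 1 "\<alpha> + \<theta>"]
    by (simp_all add: a[THEN arg_cong[of _ _ "\<lambda>a. wedge a (cis t)"]]
        b[THEN arg_cong[of _ _ "wedge (cis t)"]])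
  have open_iff: "cis t \<in> open_corner a b \<longleftrightarrow> sin (t - \<alpha>) > 0 \<and> sin (\<alpha> + \<theta> - t) > 0"
    and closed_iff: "cis t \<in> corner a b \<longleftrightarrow> sin (t - \<alpha>) \<ge> 0 \<and> sin (\<alpha> + \<theta> - t) \<ge> 0" for t
  proof -
    have "0 < k * s * wedge a b \<longleftrightarrow> 0 < s" "0 \<le> k * s * wedge a b \<longleftrightarrow> 0 \<le> s" if "k > 0" for k s
      using that assms by (simp_all add: zero_less_mult_iff zero_le_mult_iff)
    then show "cis t \<in> open_corner a b \<longleftrightarrow> sin (t - \<alpha>) > 0 \<and> sin (\<alpha> + \<theta> - t) > 0"
      "cis t \<in> corner a b \<longleftrightarrow> sin (t - \<alpha>) \<ge> 0 \<and> sin (\<alpha> + \<theta> - t) \<ge> 0"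
      using xy by (simp_all add: open_corner_def corner_def wedges)
  qed
  \<comment> \<open>The arc from \<open>\<alpha>\<close> to \<open>\<alpha> + \<theta>\<close> is cut at \<open>2*pi\<close>; the part beyond, if any, reappears at \<open>0\<close>.\<close>
  define e where "e = min (\<alpha> + \<theta>) (2*pi)"
  have e: "\<alpha> \<le> e" "e \<le> 2*pi" "(e - \<alpha>) + max 0 (\<alpha> + \<theta> - 2*pi) = \<theta>" using \<alpha>(1,2) \<theta> by (auto simp: e_def)
  have len: "measure lborel {0<..<u} = max 0 u" "measure lborel {0..u} = max 0 u" for u :: real
    by (cases "u \<ge> 0"; simp)+
  have "measure lborel ({\<alpha><..<e} \<union> {0<..<\<alpha>+\<theta>-2*pi})
      = measure lborel {\<alpha><..<e} + measure lborel {0<..<\<alpha>+\<theta>-2*pi}"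
    using \<alpha>(1,2) \<theta> emeasure_bounded_finite[of "{\<alpha><..<e}"]
      emeasure_bounded_finite[of "{0<..<\<alpha>+\<theta>-2*pi}"]
    by (intro measure_Union) auto
  also have "\<dots> = \<theta>" unfolding len measure_lborel_Ioo[OF e(1)] by (rule e(3))
  finally have "\<theta> = measure lborel ({\<alpha><..<e} \<union> {0<..<\<alpha>+\<theta>-2*pi})" by simp
  also have "\<dots> \<le> measure lborel (directions (open_corner a b))"
  proof (rule measure_mono_fmeasurable)
    show "{\<alpha><..<e} \<union> {0<..<\<alpha>+\<theta>-2*pi} \<subseteq> directions (open_corner a b)"
    proof
      fix t assume t: "t \<in> {\<alpha><..<e} \<union> {0<..<\<alpha>+\<theta>-2*pi}"
      show "t \<in> directions (open_corner a b)"
      proof (cases "t \<in> {\<alpha><..<e}")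
        case True
        then show ?thesis using \<alpha>(1,2) \<theta> by (auto simp: open_iff e_def intro!: sin_gt_zero)
      next
        case False
        then have t: "0 < t" "t < \<alpha> + \<theta> - 2*pi" using t by auto
        have "sin (t - \<alpha>) > 0"
          using sin_gt_zero[of "t - \<alpha> + 2*pi"] t \<alpha>(1,2) \<theta> by simp
        moreover have "sin (\<alpha> + \<theta> - t) > 0"
          using sin_gt_zero[of "\<alpha> + \<theta> - t - 2*pi"] t \<alpha>(1,2) \<theta> by (simp add: sin_diff)
        ultimately show ?thesis using t \<alpha>(1,2) \<theta> by (simp add: open_iff)
      qed
    qed
    show "directions (open_corner a b) \<in> fmeasurable lborel"
      by (intro directions_measurable borel_open open_open_corner)
  qed auto
  finally show "corner_angle a b \<le> measure lborel (directions (open_corner a b))"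
    by (simp add: angle)
  have fin: "emeasure lborel ({\<alpha>..e} \<union> {0..\<alpha>+\<theta>-2*pi}) < \<infinity>"
    by (intro emeasure_bounded_finite) auto
  have "measure lborel (directions (corner a b)) \<le> measure lborel ({\<alpha>..e} \<union> {0..\<alpha>+\<theta>-2*pi})"
  proof (rule measure_mono_fmeasurable)
    show "directions (corner a b) \<subseteq> {\<alpha>..e} \<union> {0..\<alpha>+\<theta>-2*pi}"
    proof
      fix t assume t: "t \<in> directions (corner a b)"
      then have s: "sin (t - \<alpha>) \<ge> 0" "sin (\<alpha> + \<theta> - t) \<ge> 0" by (auto simp: closed_iff)
      show "t \<in> {\<alpha>..e} \<union> {0..\<alpha>+\<theta>-2*pi}"
      proof (cases "t \<ge> \<alpha>")
        case True
        have "t \<le> \<alpha> + \<theta>"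
        proof (rule ccontr)
          assume "\<not> t \<le> \<alpha> + \<theta>"
          then have "t - \<alpha> > pi" using s(2) sin_neg_left[of "\<alpha> + \<theta> - t"] \<theta> by linarith
          then show False using s(1) sin_lt_zero[of "t - \<alpha>"] t \<alpha>(1,2) by simp
        qed
        then show ?thesis using True t by (auto simp: e_def)
      next
        case False
        then have "t - \<alpha> \<le> -pi" using s(1) sin_neg_left[of "t - \<alpha>"] by linarith
        moreover have "sin (\<alpha> + \<theta> - t) = sin (\<alpha> + \<theta> - t - 2*pi)" by (simp add: sin_diff)
        ultimately have "t \<le> \<alpha> + \<theta> - 2*pi"
          using s(2) sin_neg_left[of "\<alpha> + \<theta> - t - 2*pi"] \<theta> by linarith
        then show ?thesis using t by auto
      qed
    qed
    show "directions (corner a b) \<in> sets lborel"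
      using directions_measurable[OF borel_closed[OF closed_corner], of a b] by (simp add: fmeasurable_def)
  qed (use fin in \<open>auto simp: fmeasurable_def\<close>)
  also have "\<dots> \<le> measure lborel {\<alpha>..e} + measure lborel {0..\<alpha>+\<theta>-2*pi}"
    by (rule measure_Un_le) auto
  also have "\<dots> = \<theta>" unfolding len measure_lborel_Icc[OF e(1)] by (rule e(3))
  finally show "measure lborel (directions (corner a b)) \<le> corner_angle a b" by (simp add: angle)
qed

lemma corner_measure:
  assumes "wedge a b \<noteq> 0"
  shows "corner_angle a b \<le> measure lborel (directions (open_corner a b))"
    and "measure lborel (directions (corner a b)) \<le> corner_angle a b"
proof -
  have *: "corner_angle b a = corner_angle a b"
    by (simp add: corner_angle_def inner_commute mult.commute)
  consider "wedge a b > 0" | "wedge b a > 0" using assms wedge_swap[of a b] by linarith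
  then have "corner_angle a b \<le> measure lborel (directions (open_corner a b)) \<and>
      measure lborel (directions (corner a b)) \<le> corner_angle a b"
  proof cases
    case 1
    then show ?thesis using positively_oriented_corner_measure[of a b] by blast
  next
    case 2
    then show ?thesis
      using positively_oriented_corner_measure[of b a] unfolding * corner_swap[of a b] by blast
  qed
  then show "corner_angle a b \<le> measure lborel (directions (open_corner a b))"
    "measure lborel (directions (corner a b)) \<le> corner_angle a b" by blast+
qed

section \<open>Tangency layouts and their angle sums\<close>

text \<open>The combinatorial form of being an inner vertex: no edge at \<open>v\<close> is a border edge.\<close>

definition surrounded :: "'v set set \<Rightarrow> 'v \<Rightarrow> bool" where
  "surrounded F v \<longleftrightarrow> (\<exists>t\<in>F. v \<in> t) \<and>
     (\<forall>t\<in>F. v \<in> t \<longrightarrow> (\<forall>w\<in>t - {v}. \<exists>t'\<in>F. t' \<noteq> t \<and> v \<in> t' \<and> w \<in> t'))"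

text \<open>The angle at \<open>v\<close> in the triangle \<open>t\<close> with sides \<open>r a + r b\<close>, by the law of cosines. The
  product over the two other vertices makes it visibly symmetric and monotone in their radii.\<close>

definition radius_angle :: "('v \<Rightarrow> real) \<Rightarrow> 'v \<Rightarrow> 'v set \<Rightarrow> real" where
  "radius_angle r v t = arccos (1 - 2 * (\<Prod>w\<in>t - {v}. r w / (r v + r w)))"

text \<open>What the rest of the plane geometry uses of a packing: mutually tangent circles
  for every face, and faces whose triangles do not overlap. The faces are arbitrary sets of three
  vertices, so that two layouts of the same complex can be compared.\<close>

locale tangency_layout =
  fixes F :: "'v set set" and p :: "'v \<Rightarrow> complex" and r :: "'v \<Rightarrow> real"
  assumes finite_faces: "finite F"
    and card_face: "t \<in> F \<Longrightarrow> card t = 3"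
    and radius_pos: "t \<in> F \<Longrightarrow> a \<in> t \<Longrightarrow> r a > 0"
    and dist_centres: "t \<in> F \<Longrightarrow> a \<in> t \<Longrightarrow> b \<in> t \<Longrightarrow> a \<noteq> b \<Longrightarrow> dist (p a) (p b) = r a + r b"
    and faces_disjoint: "t \<in> F \<Longrightarrow> t' \<in> F \<Longrightarrow> t \<noteq> t' \<Longrightarrow>
       interior (convex hull (p ` t)) \<inter> interior (convex hull (p ` t')) = {}"
begin

abbreviation vec :: "'v \<Rightarrow> 'v \<Rightarrow> complex" where
  "vec a b \<equiv> p b - p a"

lemma face_at_vertex:
  assumes "t \<in> F" "v \<in> t"
  obtains a b where "t = {v, a, b}" "a \<noteq> b" "a \<noteq> v" "b \<noteq> v"
  using card_face[OF assms(1)] assms(2) unfolding card_3_iff by (metis insert_iff insert_commute singletonD)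

lemma face_on_edge:
  assumes "t \<in> F" "v \<in> t" "w \<in> t" "v \<noteq> w"
  obtains b where "t = {v, w, b}" "b \<noteq> w" "b \<noteq> v"
  using card_face[OF assms(1)] assms(2-) unfolding card_3_iff by (metis insert_iff insert_commute singletonD)

text \<open>The law of cosines: with \<open>A = r v + r a\<close> and \<open>B = r v + r b\<close>, the third side gives
  \<open>2 * (A * B - inner) = (r a + r b)\<^sup>2 - (r a - r b)\<^sup>2 = 4 * r a * r b\<close>.\<close>

lemma cosine_of_corner:
  assumes "{v, a, b} \<in> F" "a \<noteq> b" "a \<noteq> v" "b \<noteq> v"
  shows "(vec v a \<bullet> vec v b) / (norm (vec v a) * norm (vec v b))
       = 1 - 2 * (\<Prod>w\<in>{v, a, b} - {v}. r w / (r v + r w))"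
proof -
  have pos: "r v > 0" "r a > 0" "r b > 0" using radius_pos[OF assms(1)] by auto
  have d: "norm (vec v a) = r v + r a" "norm (vec v b) = r v + r b"
    "norm (vec v a - vec v b) = r a + r b"
    using dist_centres[OF assms(1), of a v] dist_centres[OF assms(1), of b v]
      dist_centres[OF assms(1), of a b] assms(2-) by (auto simp: dist_norm)
  have "{v, a, b} - {v} = {a, b}" using assms by auto
  then have P: "(\<Prod>w\<in>{v, a, b} - {v}. r w / (r v + r w)) = (r a * r b) / ((r v + r a) * (r v + r b))"
    using assms by simp
  have "2 * (vec v a \<bullet> vec v b) = (norm (vec v a))\<^sup>2 + (norm (vec v b))\<^sup>2 - (norm (vec v a - vec v b))\<^sup>2"
    by (simp add: power2_norm_eq_inner inner_diff_left inner_diff_right inner_commute)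
  then have "vec v a \<bullet> vec v b = (r v + r a) * (r v + r b) - 2 * (r a * r b)"
    unfolding d by (simp add: power2_eq_square algebra_simps)
  then show ?thesis unfolding P d using pos by (simp add: diff_divide_distrib)
qed

lemma radius_product_bounds:
  assumes "t \<in> F" "v \<in> t"
  shows "0 < (\<Prod>w\<in>t - {v}. r w / (r v + r w))" "(\<Prod>w\<in>t - {v}. r w / (r v + r w)) < 1"
proof -
  obtain a b where t: "t = {v, a, b}" "a \<noteq> b" "a \<noteq> v" "b \<noteq> v" using face_at_vertex assms by metis
  have pos: "r v > 0" "r a > 0" "r b > 0" using radius_pos[OF assms(1)] t(1) by auto
  have "t - {v} = {a, b}" using t by auto
  then have P: "(\<Prod>w\<in>t - {v}. r w / (r v + r w)) = (r a / (r v + r a)) * (r b / (r v + r b))"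
    using t by simp
  show "0 < (\<Prod>w\<in>t - {v}. r w / (r v + r w))" unfolding P using pos by simp
  have "(r a / (r v + r a)) * (r b / (r v + r b)) < 1 * 1"
    using pos by (intro mult_strict_mono) auto
  then show "(\<Prod>w\<in>t - {v}. r w / (r v + r w)) < 1" unfolding P by simp
qed

lemma corner_angle_eq_radius_angle:
  assumes "{v, a, b} \<in> F" "a \<noteq> b" "a \<noteq> v" "b \<noteq> v"
  shows "corner_angle (vec v a) (vec v b) = radius_angle r v {v, a, b}"
  unfolding corner_angle_def radius_angle_def cosine_of_corner[OF assms] ..

text \<open>Three mutually tangent circles have non-collinear centres, since the cosine
  above lies strictly between \<open>-1\<close> and \<open>1\<close>.\<close>

lemma wedge_face_nonzero:
  assumes "{v, a, b} \<in> F" "a \<noteq> b" "a \<noteq> v" "b \<noteq> v"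
  shows "wedge (vec v a) (vec v b) \<noteq> 0"
proof
  assume 0: "wedge (vec v a) (vec v b) = 0"
  define P where "P = (\<Prod>w\<in>{v, a, b} - {v}. r w / (r v + r w))"
  have P: "0 < P" "P < 1" unfolding P_def using radius_product_bounds[OF assms(1), of v] by auto
  define N where "N = norm (vec v a) * norm (vec v b)"
  have "r v + r a \<noteq> 0" "r v + r b \<noteq> 0"
    using radius_pos[OF assms(1), of v] radius_pos[OF assms(1), of a]
      radius_pos[OF assms(1), of b] by auto
  then have "N \<noteq> 0"
    using dist_centres[OF assms(1), of a v] dist_centres[OF assms(1), of b v]
      assms(2-) by (auto simp: N_def dist_norm add.commute)
  have "(vec v a \<bullet> vec v b) / N = 1 - 2 * P"
    unfolding N_def P_def by (rule cosine_of_corner[OF assms])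
  then have "vec v a \<bullet> vec v b = N * (1 - 2 * P)"
    by (simp only: nonzero_divide_eq_eq[OF \<open>N \<noteq> 0\<close>] mult.commute)
  moreover have "(vec v a \<bullet> vec v b)\<^sup>2 = N\<^sup>2"
    using wedge_inner_squares[of "vec v a" "vec v b"] 0 by (simp add: N_def power_mult_distrib)
  ultimately have "(1 - 2 * P)\<^sup>2 = 1" using \<open>N \<noteq> 0\<close> by (simp add: power_mult_distrib)
  then have "P * (P - 1) = 0" by (simp add: power2_eq_square algebra_simps)
  then show False using P by simp
qed

lemma open_corners_disjoint:
  assumes "{v, a, b} \<in> F" "{v, c, d} \<in> F" "{v, a, b} \<noteq> {v, c, d}"
  shows "open_corner (vec v a) (vec v b) \<inter> open_corner (vec v c) (vec v d) = {}"
proof (rule ccontr)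
  assume "\<not> ?thesis"
  then obtain z where z: "z \<in> open_corner (vec v a) (vec v b)" "z \<in> open_corner (vec v c) (vec v d)"
    by blast
  obtain \<delta> where \<delta>: "\<delta> > 0"
    "\<And>\<epsilon>. 0 < \<epsilon> \<Longrightarrow> \<epsilon> < \<delta> \<Longrightarrow> p v + \<epsilon> *\<^sub>R z \<in> interior (convex hull {p v, p a, p b})"
    using open_corner_meets_triangle[OF z(1)] by blast
  obtain \<delta>' where \<delta>': "\<delta>' > 0"
    "\<And>\<epsilon>. 0 < \<epsilon> \<Longrightarrow> \<epsilon> < \<delta>' \<Longrightarrow> p v + \<epsilon> *\<^sub>R z \<in> interior (convex hull {p v, p c, p d})"
    using open_corner_meets_triangle[OF z(2)] by blast
  define \<epsilon> where "\<epsilon> = min \<delta> \<delta>' / 2"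
  have "0 < \<epsilon>" "\<epsilon> < \<delta>" "\<epsilon> < \<delta>'" using \<delta> \<delta>' by (auto simp: \<epsilon>_def)
  then show False using \<delta>(2)[of \<epsilon>] \<delta>'(2)[of \<epsilon>] faces_disjoint[OF assms] by auto
qed

text \<open>Two faces on the same side of a common edge would overlap near an end of that edge.\<close>

lemma opposite_sides:
  assumes "{v, a, b} \<in> F" "{v, a, b'} \<in> F" "b \<noteq> b'" "a \<noteq> v" "b \<noteq> v" "b' \<noteq> v" "a \<noteq> b" "a \<noteq> b'"
  shows "wedge (vec v a) (vec v b) * wedge (vec v a) (vec v b') < 0"
proof -
  have "{v, a, b} \<noteq> {v, a, b'}" using assms(3-) by auto
  then have "\<not> wedge (vec v a) (vec v b) * wedge (vec v a) (vec v b') > 0"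
    using open_corners_disjoint[OF assms(1,2)] same_side_open_corners_meet by blast
  moreover have "wedge (vec v a) (vec v b) * wedge (vec v a) (vec v b') \<noteq> 0"
    using wedge_face_nonzero assms by auto
  ultimately show ?thesis by linarith
qed

definition corners_at :: "'v \<Rightarrow> complex set" where
  "corners_at v = (\<Union>(a, b)\<in>{(a, b). {v, a, b} \<in> F \<and> a \<noteq> b \<and> a \<noteq> v \<and> b \<noteq> v}. corner (vec v a) (vec v b))"

lemma corners_atI:
  "z \<in> corner (vec v a) (vec v b) \<Longrightarrow> {v, a, b} \<in> F \<Longrightarrow> a \<noteq> b \<Longrightarrow> a \<noteq> v \<Longrightarrow> b \<noteq> v
    \<Longrightarrow> z \<in> corners_at v"
  unfolding corners_at_def by blast

lemma closed_corners_at: "closed (corners_at v)"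
  unfolding corners_at_def
proof (rule closed_UN)
  have "finite (\<Union>F)" using finite_faces card_face
    by (intro finite_Union) (auto intro: card_ge_0_finite)
  then have "finite (\<Union>F \<times> \<Union>F)" by simp
  moreover have "{(a, b). {v, a, b} \<in> F \<and> a \<noteq> b \<and> a \<noteq> v \<and> b \<noteq> v} \<subseteq> \<Union>F \<times> \<Union>F" by auto
  ultimately show "finite {(a, b). {v, a, b} \<in> F \<and> a \<noteq> b \<and> a \<noteq> v \<and> b \<noteq> v}"
    by (rule rev_finite_subset)
qed (auto intro: closed_corner)

text \<open>A point strictly inside a corner has the open corner as a neighbourhood. A point on
  the ray through \<open>a\<close> is surrounded by two corners, because the edge from \<open>v\<close> to \<open>a\<close> has a second
  face, on its other side.\<close>

lemma corner_neighbourhood: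
  assumes v: "surrounded F v" and t: "{v, a, b} \<in> F" "a \<noteq> b" "a \<noteq> v" "b \<noteq> v"
    and z: "z \<in> corner (vec v a) (vec v b)" "wedge z (vec v b) \<noteq> 0"
  obtains U where "open U" "z \<in> U" "U \<subseteq> corners_at v"
proof -
  let ?a = "vec v a" and ?b = "vec v b"
  have "\<exists>t'\<in>F. t' \<noteq> {v, a, b} \<and> v \<in> t' \<and> a \<in> t'" using v t by (simp add: surrounded_def)
  then obtain t' where t': "t' \<in> F" "t' \<noteq> {v, a, b}" "v \<in> t'" "a \<in> t'" by blast
  obtain c where c: "t' = {v, a, c}" "c \<noteq> a" "c \<noteq> v" using face_on_edge t' t(3) by metis
  let ?c = "vec v c"
  have "wedge ?a ?b * wedge ?a ?c < 0" using opposite_sides t t' c by blast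
  note opp = this
  have zb: "wedge z ?b * wedge ?a ?b > 0"
    using z wedge_face_nonzero[OF t] by (auto simp: corner_def less_le)
  show thesis
  proof (cases "wedge ?a z = 0")
    case False
    then have "z \<in> open_corner ?a ?b" using z wedge_face_nonzero[OF t] by (auto simp: corner_def open_corner_def less_le)
    moreover have "open_corner ?a ?b \<subseteq> corners_at v"
      using t open_corner_subset_corner by (blast intro: corners_atI)
    ultimately show thesis using that open_open_corner by blast
  next
    case True
    define s where "s = wedge z ?b / wedge ?a ?b"
    \<comment> \<open>On the ray through \<open>a\<close> neither corner alone is a neighbourhood, but nearby points lie on one
      side of the ray or the other.\<close>
    have "z = s *\<^sub>R ?a" using wedge_cramer[OF wedge_face_nonzero[OF t], of z] True by (simp add: s_def)
    moreover have s: "s > 0" using zb by (simp add: s_def zero_less_divide_iff zero_less_mult_iff)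
    ultimately have zc: "wedge z ?c * wedge ?a ?c > 0"
      using opp by (auto simp: zero_less_mult_iff mult_less_0_iff)
    define U where "U = {w. wedge w ?b * wedge ?a ?b > 0 \<and> wedge w ?c * wedge ?a ?c > 0}"
    have "open U" unfolding U_def by (intro open_Collect_conj open_Collect_less continuous_intros)
    moreover have "z \<in> U" using zb zc by (simp add: U_def)
    moreover have "U \<subseteq> corners_at v"
    proof
      fix w assume w: "w \<in> U"
      have "wedge ?a w * wedge ?a ?b \<ge> 0 \<or> wedge ?a w * wedge ?a ?c \<ge> 0"
        using opp by (auto simp: zero_le_mult_iff mult_less_0_iff)
      then have "w \<in> corner ?a ?b \<or> w \<in> corner ?a ?c" using w by (auto simp: U_def corner_def)
      then show "w \<in> corners_at v"
        using corners_atI[OF _ t] corners_atI[where z=w and v=v and a=a and b=c] t t' c by blast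
    qed
    ultimately show thesis using that by blast
  qed
qed

text \<open>The corners at \<open>v\<close>, without the apex, form a non-empty subset of the punctured plane
  that is closed and, by the previous lemma, open. The punctured plane is connected.\<close>

lemma corners_cover:
  assumes "surrounded F v"
  shows "corners_at v = UNIV"
proof -
  let ?T = "corners_at v - {0}"
  have "\<exists>U. open U \<and> z \<in> U \<and> U \<subseteq> ?T" if z: "z \<in> ?T" for z
  proof -
    obtain a b where t: "{v, a, b} \<in> F" "a \<noteq> b" "a \<noteq> v" "b \<noteq> v"
      and zc: "z \<in> corner (vec v a) (vec v b)" using z unfolding corners_at_def by blast
    have "\<exists>U. open U \<and> z \<in> U \<and> U \<subseteq> corners_at v"
    proof (cases "wedge z (vec v b) = 0")
      case False
      obtain U where "open U" "z \<in> U" "U \<subseteq> corners_at v"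
        by (rule corner_neighbourhood[OF assms t zc False])
      then show ?thesis by blast
    next
      case True
      have t': "{v, b, a} \<in> F" using t by (simp add: insert_commute)
      have "wedge (vec v a) z \<noteq> 0"
        using True z wedge_cramer[OF wedge_face_nonzero[OF t], of z] by auto
      then have za: "wedge z (vec v a) \<noteq> 0" using wedge_swap[of z "vec v a"] by simp
      have "z \<in> corner (vec v b) (vec v a)" using zc by (subst corner_swap)
      then obtain U where "open U" "z \<in> U" "U \<subseteq> corners_at v"
        by (rule corner_neighbourhood[OF assms t' t(2)[symmetric] t(4,3) _ za])
      then show ?thesis by blast
    qed
    then obtain U where "open U" "z \<in> U" "U \<subseteq> corners_at v" by blast
    then show ?thesis using z by (intro exI[of _ "U - {0}"]) auto
  qed
  then have "open ?T" using open_subopen[of ?T] by blast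
  then have "openin (top_of_set (- {0})) ?T"
    by (rule open_subset[rotated]) auto
  moreover have "closedin (top_of_set (- {0})) ?T"
    using closedin_closed_Int[OF closed_corners_at, of "- {0}" v] by (simp add: Diff_eq Int_commute)
  moreover have "connected (- {0 :: complex})" by (rule connected_punctured_universe) simp
  moreover have "?T \<noteq> {}"
  proof -
    obtain t where "t \<in> F" "v \<in> t" using assms by (auto simp: surrounded_def)
    then obtain a b where t: "{v, a, b} \<in> F" "a \<noteq> b" "a \<noteq> v" "b \<noteq> v"
      using face_at_vertex by metis
    have "vec v a \<in> corners_at v" by (rule corners_atI[OF _ t]) (simp add: corner_def)
    moreover have "vec v a \<noteq> 0" using wedge_face_nonzero[OF t] by (auto simp: wedge_def)
    ultimately show ?thesis by blast
  qed
  ultimately have T: "?T = - {0}" by (meson connected_clopen)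
  moreover from T have "closure (- {0}) \<subseteq> corners_at v"
    using closed_corners_at[of v] by (metis Diff_subset closure_minimal)
  ultimately show ?thesis by (simp add: closure_complement top.extremum_unique)
qed

text \<open>The direction \<open>1\<close> lies in some corner; so it is a non-negative combination of
  the two edge vectors, one of which then points to the right.\<close>

lemma surrounded_not_extreme:
  assumes v: "surrounded F v"
  obtains t w where "t \<in> F" "v \<in> t" "w \<in> t" "Re (p w) > Re (p v)"
proof -
  have "1 \<in> corners_at v" using corners_cover[OF v] by simp
  then obtain a b where t: "{v, a, b} \<in> F" "a \<noteq> b" "a \<noteq> v" "b \<noteq> v"
    and c: "1 \<in> corner (vec v a) (vec v b)" unfolding corners_at_def by blast
  define s u where "s = wedge 1 (vec v b) / wedge (vec v a) (vec v b)"
    "u = wedge (vec v a) 1 / wedge (vec v a) (vec v b)"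
  have su: "s \<ge> 0" "u \<ge> 0"
    using c by (auto simp: s_u_def corner_def zero_le_mult_iff zero_le_divide_iff)
  have "1 = s *\<^sub>R vec v a + u *\<^sub>R vec v b"
    unfolding s_u_def by (rule wedge_cramer[OF wedge_face_nonzero[OF t]])
  then have "Re 1 = s * Re (vec v a) + u * Re (vec v b)" by (metis plus_complex.sel(1) scaleR_complex.sel(1))
  then have "Re (vec v a) > 0 \<or> Re (vec v b) > 0"
    using su by (smt (verit) mult_nonneg_nonpos one_complex.sel(1))
  then show thesis using that[OF t(1)] by auto
qed

text \<open>The open corners are disjoint, so their angles sum to at most the full circle; the
  closed corners cover, so they sum to at least that.\<close>

theorem angle_sum:
  assumes v: "surrounded F v"
  shows "(\<Sum>t | t \<in> F \<and> v \<in> t. radius_angle r v t) = 2 * pi"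
proof -
  let ?S = "{t \<in> F. v \<in> t}"
  have fin: "finite ?S" using finite_faces by simp
  have "\<forall>t\<in>?S. \<exists>ab. t = {v, fst ab, snd ab} \<and> fst ab \<noteq> snd ab \<and> fst ab \<noteq> v \<and> snd ab \<noteq> v"
  proof
    fix t assume "t \<in> ?S"
    then have "t \<in> F" "v \<in> t" by auto
    then obtain a b where "t = {v, a, b}" "a \<noteq> b" "a \<noteq> v" "b \<noteq> v" by (rule face_at_vertex)
    then show "\<exists>ab. t = {v, fst ab, snd ab} \<and> fst ab \<noteq> snd ab \<and> fst ab \<noteq> v \<and> snd ab \<noteq> v"
      by (intro exI[of _ "(a, b)"]) simp
  qed
  from bchoice[OF this] obtain f where
    f: "\<And>t. t \<in> ?S \<Longrightarrow> t = {v, fst (f t), snd (f t)} \<and> fst (f t) \<noteq> snd (f t) \<and> fst (f t) \<noteq> v \<and> snd (f t) \<noteq> v"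
    by blast
  define A B where "A = (\<lambda>t. vec v (fst (f t)))" "B = (\<lambda>t. vec v (snd (f t)))"
  have w0: "wedge (A t) (B t) \<noteq> 0" and ang: "corner_angle (A t) (B t) = radius_angle r v t" if "t \<in> ?S" for t
  proof -
    have "{v, fst (f t), snd (f t)} \<in> F" using that f[OF that] by simp
    then show "wedge (A t) (B t) \<noteq> 0" "corner_angle (A t) (B t) = radius_angle r v t"
      using wedge_face_nonzero[of v "fst (f t)" "snd (f t)"] f[OF that]
        corner_angle_eq_radius_angle[of v "fst (f t)" "snd (f t)"]
      unfolding A_B_def by auto
  qed
  have full: "{0..<2*pi} \<in> fmeasurable lborel"
    using emeasure_bounded_finite[of "{0..<2*pi}"] by (auto simp: fmeasurable_def)
  have mo: "directions (open_corner (A t) (B t)) \<in> fmeasurable lborel"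
    and mc: "directions (corner (A t) (B t)) \<in> fmeasurable lborel" for t
    by (rule directions_measurable[OF borel_open[OF open_open_corner]])
      (rule directions_measurable[OF borel_closed[OF closed_corner]])
  have "(\<Sum>t\<in>?S. radius_angle r v t) \<le> (\<Sum>t\<in>?S. measure lborel (directions (open_corner (A t) (B t))))"
    using corner_measure(1)[OF w0] ang by (intro sum_mono) simp
  also have "\<dots> = measure lborel (\<Union>t\<in>?S. directions (open_corner (A t) (B t)))"
  proof (rule measure_finite_Union[symmetric])
    show "disjoint_family_on (\<lambda>t. directions (open_corner (A t) (B t))) ?S"
      unfolding disjoint_family_on_def
    proof (intro ballI impI)
      fix t t' assume t: "t \<in> ?S" "t' \<in> ?S" "t \<noteq> t'"
      have "open_corner (A t) (B t) \<inter> open_corner (A t') (B t') = {}"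
        unfolding A_B_def using f[OF t(1)] f[OF t(2)] t by (intro open_corners_disjoint) auto
      then show "directions (open_corner (A t) (B t)) \<inter> directions (open_corner (A t') (B t')) = {}"
        by blast
    qed
  qed (use fin fmeasurableD[OF mo] fmeasurableD2[OF mo] in auto)
  also have "\<dots> \<le> measure lborel {0..<2*pi}"
    using mo full fin by (intro measure_mono_fmeasurable sets.finite_UN) (auto simp: fmeasurable_def)
  finally have le: "(\<Sum>t\<in>?S. radius_angle r v t) \<le> 2 * pi" by simp
  have "{0..<2*pi} \<subseteq> (\<Union>t\<in>?S. directions (corner (A t) (B t)))"
  proof
    fix x assume x: "x \<in> {0..<2*pi}"
    have "cis x \<in> corners_at v" using corners_cover[OF v] by simp
    then obtain a b where t: "{v, a, b} \<in> F" "a \<noteq> b" "a \<noteq> v" "b \<noteq> v"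
      and c: "cis x \<in> corner (vec v a) (vec v b)" unfolding corners_at_def by blast
    have tS: "{v, a, b} \<in> ?S" using t by simp
    define c d where "c = fst (f {v, a, b})" "d = snd (f {v, a, b})"
    have cd: "{v, a, b} = {v, c, d}" "c \<noteq> d" "c \<noteq> v" "d \<noteq> v"
      using f[OF tS] by (auto simp: c_d_def)
    have "{a, b} = {v, a, b} - {v}" using t by auto
    also have "\<dots> = {c, d}" unfolding cd(1) using cd by auto
    finally have "(c = a \<and> d = b) \<or> (c = b \<and> d = a)" by (auto simp: doubleton_eq_iff)
    then have "cis x \<in> corner (vec v c) (vec v d)"
      using c corner_swap(1)[of "vec v a" "vec v b"] by auto
    then have "cis x \<in> corner (A {v, a, b}) (B {v, a, b})" by (simp add: A_B_def c_d_def)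
    then show "x \<in> (\<Union>t\<in>?S. directions (corner (A t) (B t)))" using tS x by blast
  qed
  then have "measure lborel {0..<2*pi} \<le> measure lborel (\<Union>t\<in>?S. directions (corner (A t) (B t)))"
    using mc fin by (intro measure_mono_fmeasurable fmeasurable.finite_UN) auto
  also have "\<dots> \<le> (\<Sum>t\<in>?S. measure lborel (directions (corner (A t) (B t))))"
    using fin mc by (intro measure_UNION_le) (auto simp: fmeasurable_def)
  also have "\<dots> \<le> (\<Sum>t\<in>?S. radius_angle r v t)"
    using corner_measure(2)[OF w0] ang by (intro sum_mono) simp
  finally have "2 * pi \<le> (\<Sum>t\<in>?S. radius_angle r v t)" by simp
  then show ?thesis using le by simp
qed

end

section \<open>A maximum principle for radii\<close>

text \<open>The factor \<open>r w / (r v + r w)\<close> increases with \<open>r w / r v\<close>, and the angle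
  increases strictly with each factor. The hypothesis says that passing from \<open>s\<close> to \<open>r\<close> does not
  enlarge these quotients.\<close>

lemma radius_angle_comparison:
  assumes "tangency_layout F p r" "tangency_layout F q s" "t \<in> F" "v \<in> t"
    and ratio: "\<And>w. w \<in> t \<Longrightarrow> r w / s w \<le> r v / s v"
  shows "radius_angle r v t \<le> radius_angle s v t"
    and "radius_angle r v t = radius_angle s v t \<Longrightarrow> w \<in> t \<Longrightarrow> r w / s w = r v / s v"
proof -
  interpret R: tangency_layout F p r by fact
  interpret S: tangency_layout F q s by fact
  define x y where "x = (\<lambda>w. r w / (r v + r w))" "y = (\<lambda>w. s w / (s v + s w))"
  have pos: "r v > 0" "s v > 0" "\<And>w. w \<in> t \<Longrightarrow> r w > 0" "\<And>w. w \<in> t \<Longrightarrow> s w > 0"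
    using R.radius_pos S.radius_pos assms(3,4) by auto
  have xy: "0 < x w" "x w \<le> y w" "x w = y w \<Longrightarrow> r w / s w = r v / s v" if "w \<in> t" for w
  proof -
    have p: "r w > 0" "s w > 0" using pos that by auto
    have sum: "r v + r w > 0" "s v + s w > 0" using p pos by auto
    then show "0 < x w" using p by (simp add: x_y_def)
    have "r w * s v \<le> r v * s w" using ratio[OF that] p pos by (simp add: field_simps)
    then show "x w \<le> y w" unfolding x_y_def using sum by (simp add: divide_simps algebra_simps)
    assume "x w = y w"
    then have "r w * (s v + s w) = s w * (r v + r w)"
      unfolding x_y_def using sum by (simp add: frac_eq_eq)
    then have "r w * s v = r v * s w" by (simp add: algebra_simps)
    then show "r w / s w = r v / s v" using p pos by (simp add: frac_eq_eq)
  qed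
  obtain a b where t: "t = {v, a, b}" "a \<noteq> b" "a \<noteq> v" "b \<noteq> v"
    using R.face_at_vertex[OF assms(3,4)] by blast
  have ab: "a \<in> t" "b \<in> t" "t - {v} = {a, b}" using t by auto
  have X: "(\<Prod>w\<in>t - {v}. r w / (r v + r w)) = x a * x b"
    and Y: "(\<Prod>w\<in>t - {v}. s w / (s v + s w)) = y a * y b"
    unfolding ab(3) x_y_def using t(2) by simp_all
  have bd: "0 < x a * x b" "x a * x b < 1" "0 < y a * y b" "y a * y b < 1"
    using R.radius_product_bounds[OF assms(3,4)] S.radius_product_bounds[OF assms(3,4)]
    unfolding X Y by simp_all
  have le: "x a * x b \<le> y a * y b" using xy[OF ab(1)] xy[OF ab(2)] by (intro mult_mono) auto
  then show "radius_angle r v t \<le> radius_angle s v t"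
    unfolding radius_angle_def X Y using bd by (intro arccos_le_arccos) auto
  assume eq: "radius_angle r v t = radius_angle s v t" and w: "w \<in> t"
  have "1 - 2 * (x a * x b) = 1 - 2 * (y a * y b)"
    using eq bd unfolding radius_angle_def X Y by (subst (asm) arccos_eq_iff) auto
  then have prod: "x a * x b = y a * y b" by simp
  have "x a * x b \<le> y a * x b" "y a * x b \<le> y a * y b"
    using xy[OF ab(1)] xy[OF ab(2)] by (auto intro: mult_right_mono mult_left_mono)
  then have "x a * x b = y a * x b" "y a * x b = y a * y b" using prod by linarith+
  then have "x a = y a" "x b = y b" using xy[OF ab(1)] xy[OF ab(2)] by auto
  then show "r w / s w = r v / s v" using w t(1) xy(3) ab by auto
qed

text \<open>The set \<open>M\<close> of maximizers of the quotient of the radii is shown to be closed under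
  taking neighbours, and is then contradicted by its rightmost centre.\<close>

theorem radius_maximum_principle:
  assumes "tangency_layout F p r" "tangency_layout F q s"
    and outer: "\<And>v. v \<in> \<Union>F \<Longrightarrow> \<not> surrounded F v \<Longrightarrow> r v \<le> s v"
    and u: "u \<in> \<Union>F"
  shows "r u \<le> s u"
proof (rule ccontr)
  assume neg: "\<not> r u \<le> s u"
  interpret R: tangency_layout F p r by fact
  interpret S: tangency_layout F q s by fact
  define \<rho> where "\<rho> = (\<lambda>v. r v / s v)"
  have fin: "finite (\<Union>F)"
    using R.finite_faces R.card_face by (intro finite_Union) (auto intro: card_ge_0_finite)
  define m where "m = Max (\<rho> ` \<Union>F)"
  define M where "M = {v \<in> \<Union>F. \<rho> v = m}"
  have le_m: "\<rho> v \<le> m" if "v \<in> \<Union>F" for v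
    unfolding m_def using fin that by (intro Max_ge) auto
  have "m \<in> \<rho> ` \<Union>F" unfolding m_def using fin u by (intro Max_in) auto
  then have "M \<noteq> {}" by (auto simp: M_def)
  have "finite M" using finite_subset[OF _ fin, of M] by (auto simp: M_def)
  have "s u > 0" using u S.radius_pos by blast
  then have "\<rho> u > 1" using neg by (simp add: \<rho>_def)
  then have "m > 1" using le_m[OF u] by simp
  have surr: "surrounded F v" if "v \<in> M" for v
  proof (rule ccontr)
    assume "\<not> surrounded F v"
    then have "r v \<le> s v" using outer that by (auto simp: M_def)
    moreover have "s v > 0" using that S.radius_pos by (auto simp: M_def)
    ultimately have "\<rho> v \<le> 1" by (simp add: \<rho>_def)
    then show False using that \<open>m > 1\<close> by (simp add: M_def)
  qed
  have spread: "w \<in> M" if v: "v \<in> M" and t: "t \<in> F" "v \<in> t" "w \<in> t" for v t w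
  proof -
    have ratio: "r w / s w \<le> r v / s v" if "t' \<in> F" "w \<in> t'" for t' w
      using le_m[of w] v that by (auto simp: M_def \<rho>_def)
    have sums: "(\<Sum>t | t \<in> F \<and> v \<in> t. radius_angle r v t) = (\<Sum>t | t \<in> F \<and> v \<in> t. radius_angle s v t)"
      using R.angle_sum[OF surr[OF v]] S.angle_sum[OF surr[OF v]] by simp
    have "radius_angle r v t = radius_angle s v t"
    proof (rule sum_mono_inv[OF sums])
      fix t' assume t': "t' \<in> {t \<in> F. v \<in> t}"
      then show "radius_angle r v t' \<le> radius_angle s v t'"
        using radius_angle_comparison(1)[OF assms(1,2), of t' v] ratio by blast
    qed (use t R.finite_faces in auto)
    then have "r w / s w = r v / s v"
      using radius_angle_comparison(2)[OF assms(1,2) t(1,2)] ratio t by blast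
    then show "w \<in> M" using v t by (auto simp: M_def \<rho>_def)
  qed
  \<comment> \<open>The rightmost centre of \<open>M\<close> has a neighbour further to the right, again in \<open>M\<close>.\<close>
  have "Max ((\<lambda>v. Re (p v)) ` M) \<in> (\<lambda>v. Re (p v)) ` M"
    using \<open>finite M\<close> \<open>M \<noteq> {}\<close> by (intro Max_in) auto
  then obtain v where v: "v \<in> M" "Re (p v) = Max ((\<lambda>v. Re (p v)) ` M)" by auto
  obtain t w where "t \<in> F" "v \<in> t" "w \<in> t" and Re: "Re (p w) > Re (p v)"
    using R.surrounded_not_extreme[OF surr[OF v(1)]] by blast
  then have "w \<in> M" using spread v(1) by blast
  then have "Re (p w) \<le> Re (p v)" unfolding v(2) using \<open>finite M\<close> by (intro Max_ge) auto
  then show False using Re by simp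
qed

section \<open>Rigid motions\<close>

text \<open>The explicit form shows at once that these maps are isometries which multiply
  \<open>wedge\<close> by a constant sign.\<close>

definition rigid_motion :: "(complex \<Rightarrow> complex) \<Rightarrow> bool" where
  "rigid_motion g \<longleftrightarrow> (\<exists>u w. norm u = 1 \<and> (g = (\<lambda>z. u * z + w) \<or> g = (\<lambda>z. u * cnj z + w)))"

lemma rigid_motion_isometry:
  assumes "rigid_motion g"
  shows "dist (g x) (g y) = dist x y" and "bij g"
proof -
  obtain u w where u: "norm u = 1" and g: "g = (\<lambda>z. u * z + w) \<or> g = (\<lambda>z. u * cnj z + w)"
    using assms by (auto simp: rigid_motion_def)
  have "dist (u * a + w) (u * b + w) = dist a b" for a b
    using u by (simp add: dist_norm norm_mult flip: right_diff_distrib)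
  moreover have "dist (cnj a) (cnj b) = dist a b" for a b
    by (simp add: dist_norm flip: complex_cnj_diff)
  ultimately show *: "dist (g x) (g y) = dist x y" for x y using g by auto
  have u0: "u \<noteq> 0" using u by auto
  have "surj g"
  proof (rule surjI)
    fix y
    show "g (if g = (\<lambda>z. u * z + w) then (y - w) / u else cnj ((y - w) / u)) = y"
      using g u0 by auto
  qed
  moreover have "inj g" using * by (metis dist_eq_0_iff injI)
  ultimately show "bij g" by (simp add: bij_def)
qed

lemma wedge_unit_mult:
  assumes "norm u = 1"
  shows "wedge (u * x) (u * y) = wedge x y" "wedge (u * cnj x) (u * cnj y) = - wedge x y"
proof -
  have u2: "(Re u)\<^sup>2 + (Im u)\<^sup>2 = 1" using assms cmod_power2[of u] by simp
  have "wedge (u * x) (u * y) = ((Re u)\<^sup>2 + (Im u)\<^sup>2) * wedge x y"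
    "wedge (u * cnj x) (u * cnj y) = - ((Re u)\<^sup>2 + (Im u)\<^sup>2) * wedge x y"
    by (simp_all add: wedge_def power2_eq_square algebra_simps)
  then show "wedge (u * x) (u * y) = wedge x y" "wedge (u * cnj x) (u * cnj y) = - wedge x y"
    by (simp_all add: u2)
qed

lemma rigid_motion_wedge:
  assumes "rigid_motion g"
  obtains \<sigma> :: real where "\<sigma> = 1 \<or> \<sigma> = -1"
    "\<And>a b c. wedge (g b - g a) (g c - g a) = \<sigma> * wedge (b - a) (c - a)"
proof -
  obtain u w where u: "norm u = 1" and g: "g = (\<lambda>z. u * z + w) \<or> g = (\<lambda>z. u * cnj z + w)"
    using assms by (auto simp: rigid_motion_def)
  note W = wedge_unit_mult[OF u]
  show thesis
  proof (cases "g = (\<lambda>z. u * z + w)")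
    case True
    then show thesis using that[of 1] W by (simp flip: right_diff_distrib)
  next
    case False
    then have "g = (\<lambda>z. u * cnj z + w)" using g by blast
    then show thesis using that[of "-1"] W by (simp flip: right_diff_distrib complex_cnj_diff)
  qed
qed

text \<open>The distances of \<open>x\<close> to \<open>0\<close> and to \<open>b\<close> determine its component along \<open>b\<close>, and so the
  size of its component across \<open>b\<close>.\<close>

lemma wedge_squared_eq:
  assumes "norm x = norm y" "norm (x - b) = norm (y - b)"
  shows "b \<bullet> x = b \<bullet> y" "(wedge b x)\<^sup>2 = (wedge b y)\<^sup>2"
proof -
  have "(norm (x - b))\<^sup>2 = (norm x)\<^sup>2 - 2 * (b \<bullet> x) + (norm b)\<^sup>2" for x
    by (simp add: power2_norm_eq_inner inner_diff_left inner_diff_right inner_commute)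
  from this[of x] this[of y] show *: "b \<bullet> x = b \<bullet> y" using assms by simp
  show "(wedge b x)\<^sup>2 = (wedge b y)\<^sup>2"
    using wedge_inner_squares[of b x] wedge_inner_squares[of b y] * assms by simp
qed

text \<open>A point is determined by its distances to \<open>A\<close> and \<open>B\<close> up to reflection in the line
  through them.\<close>

lemma same_side_unique:
  assumes "dist x A = dist y A" "dist x B = dist y B"
    and "wedge (B - A) (x - A) * wedge (B - A) (y - A) > 0"
  shows "x = y"
proof -
  define b X Y where "b = B - A" "X = x - A" "Y = y - A"
  have n: "norm X = norm Y" "norm (X - b) = norm (Y - b)"
    using assms(1,2) by (simp_all add: b_X_Y_def dist_norm)
  have pos: "wedge b X * wedge b Y > 0" using assms(3) by (simp add: b_X_Y_def)
  then have w: "wedge b X = wedge b Y"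
    using wedge_squared_eq(2)[OF n] by (auto simp: power2_eq_iff mult_less_0_iff zero_less_mult_iff)
  have "wedge b (X - Y) = 0" "b \<bullet> (X - Y) = 0"
    using w wedge_squared_eq(1)[OF n] by (simp_all add: inner_diff_right) (simp add: wedge_def algebra_simps)
  then have "(norm b)\<^sup>2 * (norm (X - Y))\<^sup>2 = 0" using wedge_inner_squares[of b "X - Y"] by simp
  moreover have "b \<noteq> 0" using pos by (auto simp: wedge_def)
  ultimately show ?thesis by (simp add: b_X_Y_def)
qed

text \<open>Two rigid motions, one of each orientation, move \<open>a\<close> and \<open>b\<close> as wanted; they
  send \<open>c\<close> to the two points with the right distances.\<close>

lemma congruent_triangles_rigid_motion:
  assumes "dist a b = dist a' b'" "dist a c = dist a' c'" "dist b c = dist b' c'"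
    and nd: "wedge (b - a) (c - a) \<noteq> 0"
  obtains g where "rigid_motion g" "g a = a'" "g b = b'" "g c = c'"
proof -
  have ba: "b - a \<noteq> 0" using nd by (auto simp: wedge_def)
  define u where "u = (b' - a') / (b - a)"
  define u' where "u' = (b' - a') / cnj (b - a)"
  define g where "g = (\<lambda>z. u * z + (a' - u * a))"
  define g' where "g' = (\<lambda>z. u' * cnj z + (a' - u' * cnj a))"
  have nb: "norm (b' - a') = norm (b - a)" using assms(1) by (simp add: dist_norm norm_minus_commute)
  have "norm u = 1" "norm u' = 1" using ba nb by (simp_all add: u_def u'_def norm_divide del: complex_cnj_diff)
  then have rig: "rigid_motion g" "rigid_motion g'" unfolding rigid_motion_def g_def g'_def by blast+
  have ga: "g a = a'" "g' a = a'" by (simp_all add: g_def g'_def)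
  have gz: "g z = a' + u * (z - a)" "g' z = a' + u' * cnj (z - a)" for z
    by (simp_all add: g_def g'_def algebra_simps)
  have gb: "g b = b'" "g' b = b'"
    using ba by (simp_all add: gz u_def u'_def del: complex_cnj_diff)
  have W: "wedge (b' - a') (g c - a') = wedge (b - a) (c - a)"
    "wedge (b' - a') (g' c - a') = - wedge (b - a) (c - a)"
  proof -
    have "b' - a' = u * (b - a)" "b' - a' = u' * cnj (b - a)"
      using gb gz[of b] by (metis add_diff_cancel_left')+
    moreover have "g c - a' = u * (c - a)" "g' c - a' = u' * cnj (c - a)" by (simp_all add: gz)
    ultimately show "wedge (b' - a') (g c - a') = wedge (b - a) (c - a)"
      "wedge (b' - a') (g' c - a') = - wedge (b - a) (c - a)"
      using wedge_unit_mult(1)[OF \<open>norm u = 1\<close>, of "b - a" "c - a"]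
        wedge_unit_mult(2)[OF \<open>norm u' = 1\<close>, of "b - a" "c - a"] by metis+
  qed
  have d: "dist (h c) a' = dist c' a'" "dist (h c) b' = dist c' b'"
    if "rigid_motion h" "h a = a'" "h b = b'" for h
    using rigid_motion_isometry(1)[OF that(1), of c a] rigid_motion_isometry(1)[OF that(1), of c b]
      that(2,3) assms(2,3) by (simp_all add: dist_commute)
  have "(wedge (b' - a') (g c - a'))\<^sup>2 = (wedge (b' - a') (c' - a'))\<^sup>2"
    using d[OF rig(1) ga(1) gb(1)] by (intro wedge_squared_eq(2)) (simp_all add: dist_norm)
  then have "wedge (b' - a') (c' - a') = wedge (b - a) (c - a) \<or> wedge (b' - a') (c' - a') = - wedge (b - a) (c - a)"
    unfolding W power2_eq_iff by auto
  then show thesis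
  proof
    assume "wedge (b' - a') (c' - a') = wedge (b - a) (c - a)"
    then have "g c = c'" using d[OF rig(1) ga(1) gb(1)] nd W
      by (intro same_side_unique[of _ a' _ b']) (simp_all add: zero_less_mult_iff, linarith)
    then show thesis using that rig ga gb by blast
  next
    assume "wedge (b' - a') (c' - a') = - wedge (b - a) (c - a)"
    then have "g' c = c'" using d[OF rig(2) ga(2) gb(2)] nd W
      by (intro same_side_unique[of _ a' _ b']) (simp_all add: zero_less_mult_iff, linarith)
    then show thesis using that rig ga gb by blast
  qed
qed

text \<open>Connectedness of the graph whose vertices are the faces and whose edges are the adjacencies
  across a common edge, phrased as an induction principle.\<close>

definition edge_connected :: "'v set set \<Rightarrow> bool" where
  "edge_connected F \<longleftrightarrow>
     (\<forall>A\<subseteq>F. A \<noteq> {} \<longrightarrow> (\<forall>t\<in>A. \<forall>t'\<in>F. card (t \<inter> t') = 2 \<longrightarrow> t' \<in> A) \<longrightarrow> A = F)"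

text \<open>The set \<open>A\<close> of faces that are matched by the rigid motion fitted to one face is
  closed under adjacency: across an edge, the image of the next vertex and the vertex to be hit
  are at the same distances from the ends of the edge, and both lie opposite to a matched vertex.\<close>

theorem layout_determined_by_radii:
  assumes "tangency_layout F p r" "tangency_layout F q s"
    and radii: "\<And>v. v \<in> \<Union>F \<Longrightarrow> r v = s v"
    and conn: "edge_connected F"
  obtains g where "rigid_motion g" "\<forall>v\<in>\<Union>F. g (p v) = q v"
proof (cases "F = {}")
  case True
  have "rigid_motion (\<lambda>z. 1 * z + 0)" unfolding rigid_motion_def by (intro exI[of _ 1] exI[of _ 0]) simp
  then show thesis using that True by blast
next
  case False
  interpret R: tangency_layout F p r by fact
  interpret S: tangency_layout F q s by fact
  have same: "dist (p a) (p b) = dist (q a) (q b)" if "t \<in> F" "a \<in> t" "b \<in> t" for t a b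
  proof -
    have "r a = s a" "r b = s b" using radii that by blast+
    then show ?thesis
      using R.dist_centres[OF that] S.dist_centres[OF that] by (cases "a = b") auto
  qed
  obtain t\<^sub>0 where t0: "t\<^sub>0 \<in> F" using False by blast
  then obtain a\<^sub>0 where "a\<^sub>0 \<in> t\<^sub>0" using R.card_face by force
  then obtain b\<^sub>0 c\<^sub>0 where t0_eq: "t\<^sub>0 = {a\<^sub>0, b\<^sub>0, c\<^sub>0}" "b\<^sub>0 \<noteq> c\<^sub>0" "b\<^sub>0 \<noteq> a\<^sub>0" "c\<^sub>0 \<noteq> a\<^sub>0"
    using R.face_at_vertex[OF t0] by blast
  obtain g where g: "rigid_motion g" "g (p a\<^sub>0) = q a\<^sub>0" "g (p b\<^sub>0) = q b\<^sub>0" "g (p c\<^sub>0) = q c\<^sub>0"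
  proof (rule congruent_triangles_rigid_motion)
    show "wedge (p b\<^sub>0 - p a\<^sub>0) (p c\<^sub>0 - p a\<^sub>0) \<noteq> 0"
      using R.wedge_face_nonzero t0 t0_eq by blast
  qed (use same[OF t0] t0_eq in auto)
  obtain \<sigma> :: real where \<sigma>: "\<sigma> = 1 \<or> \<sigma> = -1"
    "\<And>a b c. wedge (g b - g a) (g c - g a) = \<sigma> * wedge (b - a) (c - a)"
    using rigid_motion_wedge[OF g(1)] by blast
  define A where "A = {t \<in> F. \<forall>v\<in>t. g (p v) = q v}"
  have "A = F"
  proof (rule conn[unfolded edge_connected_def, rule_format])
    show "A \<noteq> {}" using t0 t0_eq g by (auto simp: A_def)
    show "A \<subseteq> F" by (auto simp: A_def)
    fix t t' assume t: "t \<in> A" and t': "t' \<in> F" and c2: "card (t \<inter> t') = 2"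
    have tF: "t \<in> F" using t by (simp add: A_def)
    obtain a b where ab: "t \<inter> t' = {a, b}" "a \<noteq> b" using c2 by (auto simp: card_2_iff)
    then have mem: "a \<in> t" "b \<in> t" "a \<in> t'" "b \<in> t'" by auto
    obtain c where c: "t = {a, b, c}" "c \<noteq> b" "c \<noteq> a" using R.face_on_edge[OF tF mem(1,2) ab(2)] by blast
    obtain d where d: "t' = {a, b, d}" "d \<noteq> b" "d \<noteq> a" using R.face_on_edge[OF t' mem(3,4) ab(2)] by blast
    have gab: "g (p a) = q a" "g (p b) = q b" "g (p c) = q c" using t c by (auto simp: A_def)
    show "t' \<in> A"
    proof (cases "c = d")
      case True
      then show ?thesis using t c d by simp
    next
      case False
      have R: "wedge (p b - p a) (p c - p a) * wedge (p b - p a) (p d - p a) < 0"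
        and S: "wedge (q b - q a) (q c - q a) * wedge (q b - q a) (q d - q a) < 0"
        using R.opposite_sides[of a b c d] S.opposite_sides[of a b c d] tF t' c d False ab(2) by auto
      have "g (p d) = q d"
      proof (rule same_side_unique[of _ "q a" _ "q b"])
        show "dist (g (p d)) (q a) = dist (q d) (q a)" "dist (g (p d)) (q b) = dist (q d) (q b)"
          using rigid_motion_isometry(1)[OF g(1), of "p d" "p a"]
            rigid_motion_isometry(1)[OF g(1), of "p d" "p b"]
            same[OF t', of d a] same[OF t', of d b] gab d by simp_all
        have 1: "wedge (q b - q a) (g (p d) - q a) = \<sigma> * wedge (p b - p a) (p d - p a)"
          "wedge (q b - q a) (q c - q a) = \<sigma> * wedge (p b - p a) (p c - p a)"
          using \<sigma>(2)[where a="p a" and b="p b"] gab by metis+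
        show "wedge (q b - q a) (g (p d) - q a) * wedge (q b - q a) (q d - q a) > 0"
          using R S \<sigma>(1) unfolding 1 by (auto simp: mult_less_0_iff zero_less_mult_iff)
      qed
      then show ?thesis using t' d gab by (auto simp: A_def)
    qed
  qed
  then have "\<forall>v\<in>\<Union>F. g (p v) = q v" by (auto simp: A_def)
  with g(1) show thesis by (rule that)
qed

section \<open>Points with disc and half-disc neighbourhoods\<close>

abbreviation upper :: "complex set" where "upper \<equiv> {z. Im z \<ge> 0}"

text \<open>Charts are kept as homeomorphisms between subsets of Euclidean spaces, the form in
  which invariance of domain and of dimension apply.\<close>

definition disc_point :: "'n::euclidean_space set \<Rightarrow> 'n \<Rightarrow> bool" where
  "disc_point X x \<longleftrightarrow> (\<exists>N W f g. openin (top_of_set X) N \<and> x \<in> N \<and>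
     open (W :: complex set) \<and> homeomorphism N W f g)"

definition half_disc_point :: "'n::euclidean_space set \<Rightarrow> 'n \<Rightarrow> bool" where
  "half_disc_point X x \<longleftrightarrow> (\<exists>N W f g. openin (top_of_set X) N \<and> x \<in> N \<and>
     openin (top_of_set upper) W \<and> homeomorphism N W f g)"

text \<open>Invariance of dimension and of domain, applied to the inverse of the chart as a
  map into the affine hull of \<open>T\<close>.\<close>

lemma disc_in_low_dimension:
  fixes N :: "'n::euclidean_space set" and W :: "complex set"
  assumes "homeomorphism N W f g" "open W" "W \<noteq> {}" "N \<subseteq> T" "aff_dim T \<le> 2"
  shows "aff_dim T = 2" and "N \<subseteq> rel_interior T"
proof -
  have g: "continuous_on W g" "g ` W = N" "inj_on g W"
    using assms(1) by (auto simp: homeomorphism_def inj_on_def)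
  then have sub: "g \<in> W \<rightarrow> affine hull T" using assms(4) hull_subset[of T affine] by blast
  have "aff_dim (UNIV :: complex set) \<le> aff_dim (affine hull T)"
    by (rule invariance_of_dimension_affine_sets[of UNIV W "affine hull T" g])
      (use assms g sub in auto)
  then show "aff_dim T = 2" using assms(5) by simp
  have "openin (top_of_set (affine hull T)) (g ` W)"
    by (rule invariance_of_domain_affine_sets[of UNIV W "affine hull T" g])
      (use assms g sub in auto)
  then show "N \<subseteq> rel_interior T" using g assms(4) by (intro rel_interior_maximal) auto
qed

text \<open>The points of a half-disc off its edge have disc neighbourhoods, and they
  are dense in it.\<close>

lemma half_disc_point_open_subset_disc:
  assumes x: "half_disc_point X x" and U: "openin (top_of_set X) U" "x \<in> U"
  obtains N f g and W :: "complex set" where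
    "N \<subseteq> U" "open W" "W \<noteq> {}" "homeomorphism N W f g"
proof -
  obtain N W f g where N: "openin (top_of_set X) N" "x \<in> N"
      "openin (top_of_set upper) W" "homeomorphism N W f g"
    using x by (auto simp: half_disc_point_def)
  have fN: "f ` N = W" "g ` W = N" using N(4) by (auto simp: homeomorphism_def)
  have "openin (top_of_set N) (N \<inter> U)"
    using openin_Int[OF N(1) U(1)] openin_imp_subset[OF N(1)] by (auto intro: openin_subset_trans)
  then have "openin (top_of_set W) (f ` (N \<inter> U))" by (rule homeomorphism_imp_open_map[OF N(4)])
  then have "openin (top_of_set upper) (f ` (N \<inter> U))" using N(3) openin_trans by blast
  then obtain O1 where O1: "open O1" "f ` (N \<inter> U) = upper \<inter> O1" by (auto simp: openin_open)
  define W' where "W' = O1 \<inter> {z. Im z > 0}"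
  have "open W'" unfolding W'_def by (intro open_Int O1 open_halfspace_Im_gt)
  have W'_sub: "W' \<subseteq> f ` (N \<inter> U)" unfolding O1 W'_def by auto
  have "f x \<in> O1 \<inter> upper" using O1 N U by blast
  then have "f x \<in> O1" "Im (f x) \<ge> 0" by auto
  obtain e where e: "e > 0" "ball (f x) e \<subseteq> O1"
    using O1(1) \<open>f x \<in> O1\<close> by (auto simp: open_contains_ball)
  \<comment> \<open>A small step upwards from \<open>f x\<close> leads off the edge of the half-plane.\<close>
  have "f x + of_real (e/2) * \<i> \<in> ball (f x) e" using e by (simp add: dist_norm norm_mult)
  then have "f x + of_real (e/2) * \<i> \<in> W'" using e \<open>Im (f x) \<ge> 0\<close> by (auto simp: W'_def)
  then have "W' \<noteq> {}" by blast
  have fgW: "\<And>y. y \<in> W \<Longrightarrow> f (g y) = y" "\<And>y. y \<in> N \<Longrightarrow> g (f y) = y"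
    using N(4) by (auto simp: homeomorphism_def)
  have "g ` W' \<subseteq> N \<inter> U"
  proof
    fix y assume "y \<in> g ` W'"
    then obtain z where "z \<in> N \<inter> U" "y = g (f z)" using W'_sub by blast
    then show "y \<in> N \<inter> U" using fgW by simp
  qed
  moreover have "f ` (g ` W') = W'"
  proof -
    have "W' \<subseteq> W" using W'_sub fN by blast
    then have "f (g y) = y" if "y \<in> W'" for y using fgW that by blast
    then show ?thesis by force
  qed
  ultimately have "homeomorphism (g ` W') W' f g"
    using homeomorphism_of_subsets[OF N(4), of "g ` W'" W' W'] W'_sub fN by auto
  then show thesis using that \<open>open W'\<close> \<open>W' \<noteq> {}\<close> \<open>g ` W' \<subseteq> N \<inter> U\<close> by blast
qed

text \<open>A convex set of dimension two stays connected when a point is removed,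
  whether that point is inside it or on its edge. So no point of a surface separates it locally.\<close>

lemma half_disc_point_punctured_neighbourhood:
  assumes x: "half_disc_point X x" and V: "finite V"
  obtains N where "openin (top_of_set X) N" "x \<in> N" "N \<inter> V \<subseteq> {x}"
    "connected (N - {x})" "N - {x} \<noteq> {}"
proof -
  obtain N W f g where N: "openin (top_of_set X) N" "x \<in> N"
      "openin (top_of_set upper) W" "homeomorphism N W f g"
    using x by (auto simp: half_disc_point_def)
  have fN: "f ` N = W" "g ` W = N" using N(4) by (auto simp: homeomorphism_def)
  have fgW: "\<And>y. y \<in> W \<Longrightarrow> f (g y) = y" "\<And>y. y \<in> N \<Longrightarrow> g (f y) = y"
    using N(4) by (auto simp: homeomorphism_def)
  have "open (- (V - {x}))" using V by (intro open_Compl finite_imp_closed) simp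
  then have "openin (top_of_set N) (N \<inter> - (V - {x}))" by (rule openin_open_Int)
  then have "openin (top_of_set W) (f ` (N \<inter> - (V - {x})))" by (rule homeomorphism_imp_open_map[OF N(4)])
  then have "openin (top_of_set upper) (f ` (N \<inter> - (V - {x})))" using N(3) openin_trans by blast
  then obtain O1 where O1: "open O1" "f ` (N \<inter> - (V - {x})) = upper \<inter> O1" by (auto simp: openin_open)
  have "f x \<in> O1 \<inter> upper" using O1 N by blast
  then have fx: "f x \<in> O1" "Im (f x) \<ge> 0" by auto
  obtain e where e: "e > 0" "ball (f x) e \<subseteq> O1"
    using O1(1) fx by (auto simp: open_contains_ball)
  define D where "D = upper \<inter> ball (f x) e"
  have D_sub: "D \<subseteq> f ` (N \<inter> - (V - {x}))" unfolding D_def O1 using e by blast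
  have "convex D" unfolding D_def by (intro convex_Int convex_halfspace_Im_ge convex_ball)
  have "aff_dim D = 2"
  proof -
    have "open ({z. Im z > 0} \<inter> ball (f x) e)" by (intro open_Int open_halfspace_Im_gt open_ball)
    moreover have "f x + of_real (e/2) * \<i> \<in> {z. Im z > 0} \<inter> ball (f x) e"
      using e fx by (simp add: dist_norm norm_mult)
    then have "{z. Im z > 0} \<inter> ball (f x) e \<noteq> {}" by blast
    ultimately have "aff_dim ({z. Im z > 0} \<inter> ball (f x) e) = 2" by (simp add: aff_dim_open)
    moreover have "aff_dim ({z. Im z > 0} \<inter> ball (f x) e) \<le> aff_dim D"
      by (intro aff_dim_subset) (auto simp: D_def)
    ultimately show ?thesis using aff_dim_le_DIM[of D] by simp
  qed
  have "f x \<in> D" using fx e by (simp add: D_def)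
  have "D \<subseteq> W" using D_sub fN by blast
  have contg: "continuous_on D g"
    using N(4) \<open>D \<subseteq> W\<close> by (auto simp: homeomorphism_def intro: continuous_on_subset)
  have gD: "g ` D - {x} = g ` (D - {f x})"
    using fgW \<open>D \<subseteq> W\<close> N(2) by force
  show thesis
  proof (rule that[of "g ` D"])
    have "openin (top_of_set upper) D" unfolding D_def by (intro openin_open_Int open_ball)
    then have "openin (top_of_set W) D"
      using \<open>D \<subseteq> W\<close> N(3) by (meson openin_imp_subset openin_subset_trans)
    then have "openin (top_of_set N) (g ` D)"
      using homeomorphism_imp_open_map[OF homeomorphism_symD[OF N(4)]] by blast
    then show "openin (top_of_set X) (g ` D)" using N(1) openin_trans by blast
    show "x \<in> g ` D" using \<open>f x \<in> D\<close> fgW N(2) by force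
    show "g ` D \<inter> V \<subseteq> {x}" using D_sub fgW by force
    have "connected (D - {f x})"
      using \<open>convex D\<close> \<open>aff_dim D = 2\<close> by (intro connected_punctured_convex) auto
    then show "connected (g ` D - {x})" unfolding gD
      using contg by (intro connected_continuous_image) (auto intro: continuous_on_subset)
    have "D \<noteq> {f x}" using \<open>aff_dim D = 2\<close> by auto
    then show "g ` D - {x} \<noteq> {}" unfolding gD using \<open>f x \<in> D\<close> by blast
  qed
qed

text \<open>A separation of \<open>X - V\<close> would extend to \<open>X\<close>: each point of \<open>V\<close> joins the side on
  which its connected punctured neighbourhood lies.\<close>

lemma connected_minus_finite:
  assumes conn: "connected X" and X: "\<And>x. x \<in> X \<Longrightarrow> half_disc_point X x" and V: "finite V"
  shows "connected (X - V)"
proof (rule ccontr)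
  assume "\<not> connected (X - V)"
  then obtain E1 E2 where E: "openin (top_of_set (X - V)) E1" "openin (top_of_set (X - V)) E2"
    "X - V \<subseteq> E1 \<union> E2" "E1 \<inter> E2 = {}" "E1 \<noteq> {}" "E2 \<noteq> {}"
    unfolding connected_openin by blast
  have "openin (top_of_set X) (X - V)"
    using openin_open_Int[OF open_Compl[OF finite_imp_closed[OF V]], of X] by (simp add: Diff_eq)
  then have EX: "openin (top_of_set X) E1" "openin (top_of_set X) E2" using E openin_trans by blast+
  have EV: "E1 \<subseteq> X - V" "E2 \<subseteq> X - V" using E openin_imp_subset by blast+
  have "\<forall>x\<in>X. \<exists>N. openin (top_of_set X) N \<and> x \<in> N \<and> N \<inter> V \<subseteq> {x} \<and> connected (N - {x}) \<and> N - {x} \<noteq> {}"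
  proof
    fix x assume "x \<in> X"
    show "\<exists>N. openin (top_of_set X) N \<and> x \<in> N \<and> N \<inter> V \<subseteq> {x} \<and> connected (N - {x}) \<and> N - {x} \<noteq> {}"
      by (rule half_disc_point_punctured_neighbourhood[OF X[OF \<open>x \<in> X\<close>] V]) blast
  qed
  from bchoice[OF this] obtain N where N:
    "\<forall>x\<in>X. openin (top_of_set X) (N x) \<and> x \<in> N x \<and> N x \<inter> V \<subseteq> {x} \<and> connected (N x - {x}) \<and> N x - {x} \<noteq> {}"
    by blast
  \<comment> \<open>\<open>G\<close> adds to one side of the separation the removed points that belong to it.\<close>
  define G where "G = (\<lambda>E. E \<union> \<Union>{N x |x. x \<in> X \<inter> V \<and> N x - {x} \<subseteq> E})"
  have "openin (top_of_set X) (G E)" if "openin (top_of_set X) E" for E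
    unfolding G_def using that N by (intro openin_Un openin_Union) auto
  then have "openin (top_of_set X) (G E1)" "openin (top_of_set X) (G E2)" using EX by auto
  moreover have "X \<subseteq> G E1 \<union> G E2"
  proof
    fix x assume x: "x \<in> X"
    show "x \<in> G E1 \<union> G E2"
    proof (cases "x \<in> V")
      case False
      then show ?thesis using E x by (auto simp: G_def)
    next
      case True
      have "N x \<subseteq> X" using N x openin_imp_subset by blast
      then have sub: "N x - {x} \<subseteq> X - V" using N x by blast
      have "N x - {x} \<subseteq> E1 \<or> N x - {x} \<subseteq> E2"
      proof (rule ccontr)
        assume "\<not> ?thesis"
        then have "E1 \<inter> (N x - {x}) \<noteq> {}" "E2 \<inter> (N x - {x}) \<noteq> {}" using sub E(3) by auto
        moreover obtain O1 where O1: "open O1" "E1 = X \<inter> O1" using EX(1) by (auto simp: openin_open)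
        moreover obtain O2 where O2: "open O2" "E2 = X \<inter> O2" using EX(2) by (auto simp: openin_open)
        moreover have "O1 \<inter> O2 \<inter> (N x - {x}) = {}" "N x - {x} \<subseteq> O1 \<union> O2"
          using sub E(3,4) O1 O2 by blast+
        moreover have "connected (N x - {x})" using N x by blast
        ultimately show False using connectedD[of "N x - {x}" O1 O2] by blast
      qed
      then show ?thesis using N x True by (auto simp: G_def)
    qed
  qed
  moreover have "G E1 \<inter> G E2 = {}"
  proof (rule ccontr)
    assume "G E1 \<inter> G E2 \<noteq> {}"
    then obtain y where y: "y \<in> G E1" "y \<in> G E2" by blast
    have in_G: "y \<in> E \<or> (y \<in> X \<inter> V \<and> N y - {y} \<subseteq> E)" if "y \<in> G E" for E
      using that by (auto simp: G_def)
    show False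
    proof (cases "y \<in> V")
      case True
      then have "N y - {y} \<subseteq> E1 \<inter> E2" "y \<in> X" using in_G[OF y(1)] in_G[OF y(2)] EV by auto
      then show False using N E(4) by auto
    next
      case False
      then show False using in_G[OF y(1)] in_G[OF y(2)] E(4) by auto
    qed
  qed
  moreover have "G E1 \<noteq> {}" "G E2 \<noteq> {}" using E by (auto simp: G_def)
  ultimately show False using conn unfolding connected_openin by blast
qed

text \<open>The last conclusion keeps track of whether the chart sends the point to the edge of the
  half-plane.\<close>

lemma chart_pullback:
  assumes h: "homeomorphic_map (top_of_set X) S h" and x: "x \<in> X"
    and chart: "half_plane_chart S U \<psi>" "h x \<in> U"
  obtains N W f g where "openin (top_of_set X) N" "x \<in> N" "openin (top_of_set upper) W"
    "homeomorphism N W f g" "f x = \<psi> (h x)"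
proof -
  obtain W where W: "openin S U" "openin (top_of_set upper) W"
    "homeomorphic_map (subtopology S U) (top_of_set W) \<psi>"
    using chart(1) by (auto simp: half_plane_chart_def)
  define N where "N = {y \<in> X. h y \<in> U}"
  have "continuous_map (top_of_set X) S h" using h homeomorphic_imp_continuous_map by blast
  then have N: "openin (top_of_set X) N"
    using openin_continuous_map_preimage[OF _ W(1)] by (fastforce simp: N_def)
  have "homeomorphic_map (subtopology (top_of_set X) N) (subtopology S U) h"
    by (rule homeomorphic_map_subtopologies_alt[OF h]) (simp add: N_def)
  then have "homeomorphic_map (top_of_set N) (subtopology S U) h"
    using openin_imp_subset[OF N] by (simp add: subtopology_subtopology Int_absorb1)
  then have "homeomorphic_map (top_of_set N) (top_of_set W) (\<psi> \<circ> h)"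
    using W(3) homeomorphic_map_compose by blast
  then obtain g where "homeomorphic_maps (top_of_set N) (top_of_set W) (\<psi> \<circ> h) g"
    by (auto simp: homeomorphic_map_maps)
  then have "homeomorphism N W (\<psi> \<circ> h) g"
    by (auto simp: homeomorphic_maps_def intro!: homeomorphismI)
  then show thesis using that[of N W "\<psi> \<circ> h" g] N W(2) x chart(2) by (simp add: N_def)
qed

lemma surface_point_half_disc:
  assumes "surface S" "homeomorphic_map (top_of_set X) S h" "x \<in> X"
  shows "half_disc_point X x"
proof -
  have "h x \<in> topspace S" using assms(2,3) homeomorphic_imp_surjective_map by fastforce
  then obtain U \<psi> where U: "half_plane_chart S U \<psi>" "h x \<in> U" using assms(1) by (auto simp: surface_def)
  show ?thesis
    by (rule chart_pullback[OF assms(2,3) U]) (auto simp: half_disc_point_def)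
qed

text \<open>Off the boundary, every chart sends the point into the open half-plane, where the
  chart can be cut down to an open subset of the plane.\<close>

lemma inner_point_disc:
  assumes "surface S" "homeomorphic_map (top_of_set X) S h" "x \<in> X" "h x \<notin> surface_boundary S"
  shows "disc_point X x"
proof -
  have hx: "h x \<in> topspace S" using assms(2,3) homeomorphic_imp_surjective_map by fastforce
  then obtain U \<psi> where U: "half_plane_chart S U \<psi>" "h x \<in> U" using assms(1) by (auto simp: surface_def)
  obtain N W f g where N: "openin (top_of_set X) N" "x \<in> N" "openin (top_of_set upper) W"
    "homeomorphism N W f g" "f x = \<psi> (h x)"
    by (rule chart_pullback[OF assms(2,3) U])
  have "Im (f x) \<noteq> 0" using assms(4) hx U unfolding N(5) surface_boundary_def by blast
  moreover have "f x \<in> W" using N(2,4) by (auto simp: homeomorphism_def)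
  moreover obtain O1 where O1: "open O1" "W = upper \<inter> O1" using N(3) by (auto simp: openin_open)
  ultimately have fx: "f x \<in> O1 \<inter> {z. Im z > 0}" by auto
  define W' where "W' = O1 \<inter> {z. Im z > 0}"
  have "open W'" unfolding W'_def by (intro open_Int O1 open_halfspace_Im_gt)
  have "W' \<subseteq> W" using O1 by (auto simp: W'_def)
  have "openin (top_of_set W) W'" using \<open>W' \<subseteq> W\<close> \<open>open W'\<close> by (rule open_subset)
  then have "openin (top_of_set N) (g ` W')"
    by (rule homeomorphism_imp_open_map[OF homeomorphism_symD[OF N(4)]])
  then have "openin (top_of_set X) (g ` W')" using N(1) by (rule openin_trans)
  moreover have "x \<in> g ` W'"
    using fx homeomorphism_apply1[OF N(4) N(2)] by (force simp: W'_def)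
  moreover have "homeomorphism (g ` W') W' f g"
  proof (rule homeomorphism_symD, rule homeomorphism_of_subsets[OF homeomorphism_symD[OF N(4)] \<open>W' \<subseteq> W\<close>])
    show "g ` W' \<subseteq> N" using \<open>W' \<subseteq> W\<close> N(4) by (auto simp: homeomorphism_def)
  qed simp
  ultimately show ?thesis using \<open>open W'\<close> unfolding disc_point_def by blast
qed

section \<open>Triangulations of a surface\<close>

text \<open>The last assumption covers inner points as well as border points: a chart whose image
  avoids the edge of the half-plane is a chart onto an open set of the plane.\<close>

locale complex_on_surface =
  fixes K :: "'n::euclidean_space set set"
  assumes complex: "simplicial_complex K"
    and connected: "connected (\<Union>K)"
    and half_discs: "\<And>x. x \<in> \<Union>K \<Longrightarrow> half_disc_point (\<Union>K) x"
begin

lemma finite_K: "finite K"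
  using complex by (simp add: simplicial_complex_def)

lemma simplexE:
  assumes "\<sigma> \<in> K"
  obtains C where "\<not> affine_dependent C" "finite C" "\<sigma> = convex hull C" "aff_dim \<sigma> = int (card C) - 1"
proof -
  obtain n where "n simplex \<sigma>" using assms complex by (auto simp: simplicial_complex_def)
  then obtain C where C: "\<not> affine_dependent C" "\<sigma> = convex hull C" by (auto simp: simplex_def)
  show thesis
    using that[OF C(1) aff_independent_finite[OF C(1)] C(2)] aff_dim_affine_independent[OF C(1)]
    by (simp add: C(2) aff_dim_convex_hull)
qed

lemma convex_K: "\<sigma> \<in> K \<Longrightarrow> convex \<sigma>"
  by (metis simplexE convex_convex_hull)

lemma compact_K: "\<sigma> \<in> K \<Longrightarrow> compact \<sigma>"
  by (metis simplexE finite_imp_compact_convex_hull)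

lemma face_in_K: "\<sigma> \<in> K \<Longrightarrow> F face_of \<sigma> \<Longrightarrow> F \<in> K"
  using complex by (auto simp: simplicial_complex_def)

lemma Int_face: "\<sigma> \<in> K \<Longrightarrow> \<tau> \<in> K \<Longrightarrow> \<sigma> \<inter> \<tau> face_of \<sigma>"
  using complex by (auto simp: simplicial_complex_def)

text \<open>A proper face misses the relative interior.\<close>

lemma subset_if_meets_rel_interior:
  assumes "\<sigma> \<in> K" "\<tau> \<in> K" "x \<in> rel_interior \<sigma>" "x \<in> \<tau>"
  shows "\<sigma> \<subseteq> \<tau>"
proof -
  have "\<sigma> \<inter> \<tau> = \<sigma>"
    using face_of_disjoint_rel_interior[OF Int_face[OF assms(1,2)]] assms rel_interior_subset[of \<sigma>]
    by blast
  then show ?thesis by blast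
qed

text \<open>The complement of the simplices that avoid \<open>x\<close> is an open star of \<open>x\<close>.\<close>

lemma open_star:
  assumes "x \<in> \<Union>K"
  obtains N where "openin (top_of_set (\<Union>K)) N" "x \<in> N" "\<forall>y\<in>N. \<exists>\<sigma>\<in>K. x \<in> \<sigma> \<and> y \<in> \<sigma>"
proof
  let ?N = "\<Union>K \<inter> - \<Union>{\<sigma> \<in> K. x \<notin> \<sigma>}"
  have "closed (\<Union>{\<sigma> \<in> K. x \<notin> \<sigma>})"
    using finite_K compact_K by (intro closed_Union) (auto intro: compact_imp_closed)
  then show "openin (top_of_set (\<Union>K)) ?N" by (intro openin_open_Int open_Compl)
  show "x \<in> ?N" using assms by blast
  show "\<forall>y\<in>?N. \<exists>\<sigma>\<in>K. x \<in> \<sigma> \<and> y \<in> \<sigma>" by blast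
qed

text \<open>The interior of a simplex embeds in the plane through any chart, so invariance of
  dimension applies.\<close>

lemma aff_dim_le_2:
  assumes "\<sigma> \<in> K"
  shows "aff_dim \<sigma> \<le> 2"
proof (cases "\<sigma> = {}")
  case True
  then show ?thesis by simp
next
  case False
  then obtain x where x: "x \<in> rel_interior \<sigma>" using rel_interior_eq_empty convex_K[OF assms] by blast
  then have "x \<in> \<Union>K" using assms rel_interior_subset by blast
  then obtain N W f g where N: "openin (top_of_set (\<Union>K)) N" "x \<in> N"
      "openin (top_of_set upper) W" "homeomorphism N W f g"
    using half_discs[OF \<open>x \<in> \<Union>K\<close>] unfolding half_disc_point_def by blast
  obtain O1 where O1: "open O1" "N = \<Union>K \<inter> O1" using N(1) by (auto simp: openin_open)
  have sub: "rel_interior \<sigma> \<inter> O1 \<subseteq> N" using rel_interior_subset[of \<sigma>] assms O1 by blast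
  have "aff_dim (affine hull \<sigma>) \<le> aff_dim (UNIV :: complex set)"
  proof (rule invariance_of_dimension_affine_sets)
    show "openin (top_of_set (affine hull \<sigma>)) (rel_interior \<sigma> \<inter> O1)"
      by (intro openin_Int_open openin_rel_interior O1)
    show "continuous_on (rel_interior \<sigma> \<inter> O1) f"
      by (rule continuous_on_subset[OF homeomorphism_cont1[OF N(4)] sub])
    have "inj_on f N" using homeomorphism_apply1[OF N(4)] by (rule inj_on_inverseI)
    then show "inj_on f (rel_interior \<sigma> \<inter> O1)" using sub by (rule inj_on_subset)
    show "rel_interior \<sigma> \<inter> O1 \<noteq> {}" using x N(2) O1 by blast
  qed auto
  then show ?thesis by simp
qed

text \<open>A maximal simplex contains a neighbourhood in the polyhedron of each of its interior
  points. That neighbourhood contains a disc, so the simplex has dimension two.\<close>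

lemma in_triangle:
  assumes "\<tau> \<in> K" "\<tau> \<noteq> {}"
  obtains \<sigma> where "\<sigma> \<in> K" "\<tau> \<subseteq> \<sigma>" "aff_dim \<sigma> = 2"
proof -
  obtain \<mu> where \<mu>: "\<mu> \<in> K" "\<tau> \<subseteq> \<mu>" "\<And>\<sigma>. \<sigma> \<in> K \<Longrightarrow> \<mu> \<subseteq> \<sigma> \<Longrightarrow> \<mu> = \<sigma>"
    using finite_has_maximal2[OF finite_K assms(1)] by blast
  have "\<mu> \<noteq> {}" using assms \<mu> by blast
  then obtain x where x: "x \<in> rel_interior \<mu>" using rel_interior_eq_empty convex_K[OF \<mu>(1)] by blast
  then have xK: "x \<in> \<Union>K" using \<mu>(1) rel_interior_subset by blast
  obtain N where N: "openin (top_of_set (\<Union>K)) N" "x \<in> N" "\<forall>y\<in>N. \<exists>\<sigma>\<in>K. x \<in> \<sigma> \<and> y \<in> \<sigma>"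
    by (rule open_star[OF xK])
  have "N \<subseteq> \<mu>"
    using N(3) subset_if_meets_rel_interior[OF \<mu>(1) _ x] \<mu>(3) by blast
  obtain N' f g and W :: "complex set" where "N' \<subseteq> N" "open W" "W \<noteq> {}" "homeomorphism N' W f g"
    by (rule half_disc_point_open_subset_disc[OF half_discs[OF xK] N(1,2)])
  then have "aff_dim \<mu> = 2"
    using disc_in_low_dimension(1)[of N' W f g \<mu>] \<open>N \<subseteq> \<mu>\<close> aff_dim_le_2[OF \<mu>(1)] by blast
  then show thesis using that \<mu> by blast
qed

text \<open>Near \<open>v\<close> there is a point \<open>x\<close> in the relative interior of \<open>e\<close>. If \<open>\<tau>\<close> were the only
  triangle on \<open>e\<close>, a disc neighbourhood of \<open>x\<close> would lie in \<open>\<tau>\<close>. By invariance of domain \<open>x\<close>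
  would be interior to \<open>\<tau>\<close>, although it lies on a proper face.\<close>

lemma second_triangle:
  assumes v: "disc_point (\<Union>K) v" "v \<in> e" and e: "e face_of \<tau>" "e \<noteq> \<tau>" and \<tau>: "\<tau> \<in> K"
  obtains \<sigma> where "\<sigma> \<in> K" "aff_dim \<sigma> = 2" "e \<subseteq> \<sigma>" "\<sigma> \<noteq> \<tau>"
proof (rule ccontr)
  assume neg: "\<not> thesis"
  note second = that
  have only: "\<sigma> = \<tau>" if "\<sigma> \<in> K" "aff_dim \<sigma> = 2" "e \<subseteq> \<sigma>" for \<sigma>
    using second[OF that] neg by blast
  have eK: "e \<in> K" using face_in_K[OF \<tau> e(1)] .
  obtain N W f g where N: "openin (top_of_set (\<Union>K)) N" "v \<in> N"
      "open (W :: complex set)" "homeomorphism N W f g"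
    using v by (auto simp: disc_point_def)
  obtain O1 where O1: "open O1" "N = \<Union>K \<inter> O1" using N(1) by (auto simp: openin_open)
  have "v \<in> O1 \<inter> closure (rel_interior e)"
    using convex_closure_rel_interior[OF convex_K[OF eK]] closure_subset v(2) N(2) O1(2) by blast
  then have "O1 \<inter> rel_interior e \<noteq> {}" using open_Int_closure_eq_empty[OF O1(1)] by blast
  then obtain x where x: "x \<in> O1" "x \<in> rel_interior e" by blast
  have xe: "x \<in> e" using x rel_interior_subset by blast
  then have xK: "x \<in> \<Union>K" using eK by blast
  obtain M where M: "openin (top_of_set (\<Union>K)) M" "x \<in> M" "\<forall>y\<in>M. \<exists>\<sigma>\<in>K. x \<in> \<sigma> \<and> y \<in> \<sigma>"
    by (rule open_star[OF xK])
  have "M \<subseteq> \<tau>"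
  proof
    fix y assume "y \<in> M"
    then obtain \<sigma> where \<sigma>: "\<sigma> \<in> K" "x \<in> \<sigma>" "y \<in> \<sigma>" using M(3) by blast
    have "e \<subseteq> \<sigma>" using subset_if_meets_rel_interior[OF eK \<sigma>(1) x(2) \<sigma>(2)] .
    moreover obtain \<sigma>' where "\<sigma>' \<in> K" "\<sigma> \<subseteq> \<sigma>'" "aff_dim \<sigma>' = 2" using in_triangle \<sigma> by blast
    ultimately have "\<sigma>' = \<tau>" using only by blast
    then show "y \<in> \<tau>" using \<open>\<sigma> \<subseteq> \<sigma>'\<close> \<sigma> by blast
  qed
  have "openin (top_of_set N) (N \<inter> M)"
    using openin_Int[OF N(1) M(1)] openin_imp_subset[OF N(1)] by (auto intro: openin_subset_trans)
  then have "openin (top_of_set W) (f ` (N \<inter> M))" by (rule homeomorphism_imp_open_map[OF N(4)])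
  then have "open (f ` (N \<inter> M))" using N(3) openin_open_trans by blast
  moreover have "homeomorphism (N \<inter> M) (f ` (N \<inter> M)) f g"
    by (rule homeomorphism_of_subsets[OF N(4)]) (use N(4) in \<open>auto simp: homeomorphism_def\<close>)
  moreover have xNM: "x \<in> N \<inter> M" using x xK O1 M by blast
  ultimately have "N \<inter> M \<subseteq> rel_interior \<tau>"
    using disc_in_low_dimension(2)[of "N \<inter> M" "f ` (N \<inter> M)" f g \<tau>] \<open>M \<subseteq> \<tau>\<close> aff_dim_le_2[OF \<tau>] by blast
  then show False using face_of_disjoint_rel_interior[OF e] xe xNM by blast
qed

text \<open>A triangle is represented by its set of three vertices, the form of a face in a
  tangency layout.\<close>

definition triangles :: "'n set set" where
  "triangles = {C. \<not> affine_dependent C \<and> card C = 3 \<and> convex hull C \<in> K}"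

lemma trianglesD:
  assumes "C \<in> triangles"
  shows "\<not> affine_dependent C" "card C = 3" "finite C" "convex hull C \<in> K"
  using assms by (auto simp: triangles_def intro: card_ge_0_finite)

lemma triangle_vertex_set:
  assumes "\<sigma> \<in> K" "aff_dim \<sigma> = 2"
  obtains C where "C \<in> triangles" "\<sigma> = convex hull C"
proof -
  obtain C where "\<not> affine_dependent C" "\<sigma> = convex hull C" "aff_dim \<sigma> = int (card C) - 1"
    by (rule simplexE[OF assms(1)])
  then show thesis using that assms by (simp add: triangles_def)
qed

lemma triangles_cover: "\<Union>K = \<Union>((hull) convex ` triangles)"
proof (intro equalityI subsetI)
  fix x assume "x \<in> \<Union>K"
  then obtain \<tau> where \<tau>: "\<tau> \<in> K" "x \<in> \<tau>" by blast
  then obtain \<sigma> where "\<sigma> \<in> K" "\<tau> \<subseteq> \<sigma>" "aff_dim \<sigma> = 2" by (metis in_triangle empty_iff)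
  moreover from this obtain C where "C \<in> triangles" "\<sigma> = convex hull C" by (metis triangle_vertex_set)
  ultimately show "x \<in> \<Union>((hull) convex ` triangles)" using \<tau> by blast
qed (auto simp: triangles_def)

lemma finite_triangles: "finite triangles"
proof (rule inj_on_finite)
  show "inj_on ((hull) convex) triangles"
    using extreme_point_of_convex_hull_affine_independent trianglesD(1)
    by (metis (no_types, lifting) inj_onI subsetI subset_antisym)
  show "(hull) convex ` triangles \<subseteq> K" by (auto simp: triangles_def)
qed (rule finite_K)

lemma vertex_in_triangle:
  assumes "C \<in> triangles" "D \<in> triangles" "v \<in> D" "v \<in> convex hull C"
  shows "v \<in> C"
proof -
  have "{v} face_of convex hull D"
    using extreme_point_of_convex_hull_affine_independent[OF trianglesD(1)[OF assms(2)]] assms(3)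
    by (simp add: face_of_singleton)
  then have "{v} \<in> K" using face_in_K trianglesD(4)[OF assms(2)] by blast
  then have "convex hull C \<inter> {v} face_of convex hull C"
    using Int_face trianglesD(4)[OF assms(1)] by blast
  moreover have "convex hull C \<inter> {v} = {v}" using assms(4) by blast
  ultimately show ?thesis
    using extreme_point_of_convex_hull_affine_independent[OF trianglesD(1)[OF assms(1)]]
    by (simp add: face_of_singleton)
qed

lemma triangles_Int:
  assumes "C \<in> triangles" "D \<in> triangles"
  shows "convex hull C \<inter> convex hull D = convex hull (C \<inter> D)"
proof
  have "convex hull C \<inter> convex hull D face_of convex hull C"
    using Int_face assms trianglesD(4) by blast
  then obtain c where c: "c \<subseteq> C" "convex hull C \<inter> convex hull D = convex hull c"
    using face_of_convex_hull_affine_independent[OF trianglesD(1)[OF assms(1)]] by blast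
  have "c \<subseteq> D"
  proof
    fix v assume "v \<in> c"
    moreover have "v \<in> convex hull c" using \<open>v \<in> c\<close> by (rule hull_inc)
    ultimately show "v \<in> D" using vertex_in_triangle[OF assms(2,1)] c by blast
  qed
  then show "convex hull C \<inter> convex hull D \<subseteq> convex hull (C \<inter> D)"
    unfolding c(2) using c(1) by (intro hull_mono) blast
qed (simp add: hull_mono)

text \<open>If the faces split into two classes without adjacency, the two parts of the
  polyhedron would meet in vertices only, and removing the vertices would disconnect it.\<close>

lemma triangles_edge_connected:
  assumes A: "A \<subseteq> triangles" "A \<noteq> {}"
    and adj: "\<And>t t'. t \<in> A \<Longrightarrow> t' \<in> triangles \<Longrightarrow> card (t \<inter> t') = 2 \<Longrightarrow> t' \<in> A"
  shows "A = triangles"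
proof (rule ccontr)
  assume "A \<noteq> triangles"
  define B where "B = triangles - A"
  have B: "B \<noteq> {}" "B \<subseteq> triangles" using A \<open>A \<noteq> triangles\<close> by (auto simp: B_def)
  define V where "V = \<Union>triangles"
  have "finite V" unfolding V_def using finite_triangles trianglesD(3) by blast
  define body where "body = (\<lambda>\<T>. \<Union>((hull) convex ` \<T>) :: 'n set)"
  have closed: "closed (body \<T>)" if "\<T> \<subseteq> triangles" for \<T>
    unfolding body_def using that finite_triangles trianglesD(3)
    by (intro closed_UN finite_subset[OF that finite_triangles] ballI compact_imp_closed
        finite_imp_compact_convex_hull) blast
  have meets: "body \<T> \<inter> (\<Union>K - V) \<noteq> {}" if \<T>: "\<T> \<subseteq> triangles" "\<T> \<noteq> {}" for \<T>
  proof -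
    obtain t where t: "t \<in> \<T>" "t \<in> triangles" using \<T> by blast
    obtain a b where ab: "a \<in> t" "b \<in> t" "a \<noteq> b"
      using trianglesD(2)[OF t(2)] by (auto simp: card_3_iff)
    have "closed_segment a b \<subseteq> convex hull t"
      using ab by (simp add: segment_convex_hull hull_mono)
    moreover have "infinite (closed_segment a b)" using ab by simp
    ultimately have "\<not> convex hull t \<subseteq> V" using \<open>finite V\<close> by (meson finite_subset)
    moreover have "convex hull t \<subseteq> \<Union>K" using trianglesD(4)[OF t(2)] by blast
    moreover have "convex hull t \<subseteq> body \<T>" using t by (auto simp: body_def)
    ultimately show ?thesis by blast
  qed
  have "body A \<inter> body B \<subseteq> V"
  proof
    fix x assume "x \<in> body A \<inter> body B"
    then obtain t t' where t: "t \<in> A" "t' \<in> B" "x \<in> convex hull t" "x \<in> convex hull t'"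
      by (auto simp: body_def)
    have tt: "t \<in> triangles" "t' \<in> triangles" "t \<noteq> t'" using t A B by (auto simp: B_def)
    have x: "x \<in> convex hull (t \<inter> t')" using triangles_Int[OF tt(1,2)] t by blast
    have "card (t \<inter> t') \<noteq> 2" using adj[OF t(1) tt(2)] t by (auto simp: B_def)
    moreover have "card (t \<inter> t') \<noteq> 3"
    proof
      assume 3: "card (t \<inter> t') = 3"
      have "t \<inter> t' = t" by (rule card_subset_eq) (use 3 trianglesD[OF tt(1)] in auto)
      moreover have "t \<inter> t' = t'" by (rule card_subset_eq) (use 3 trianglesD[OF tt(2)] in auto)
      ultimately show False using tt(3) by blast
    qed
    moreover have "card (t \<inter> t') \<le> 3"
      using card_mono[of t "t \<inter> t'"] trianglesD(2,3)[OF tt(1)] by simp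
    ultimately have "card (t \<inter> t') \<le> 1" by linarith
    then consider "t \<inter> t' = {}" | y where "t \<inter> t' = {y}"
      using trianglesD(3)[OF tt(1)] by (metis One_nat_def card_0_eq card_1_singletonE finite_Int le_Suc_eq le_zero_eq)
    then show "x \<in> V"
    proof cases
      case 1 then show ?thesis using x by simp
    next
      case 2 then show ?thesis using x tt by (auto simp: V_def)
    qed
  qed
  moreover have "\<Union>K - V \<subseteq> body A \<union> body B" unfolding triangles_cover body_def B_def using A by blast
  moreover have "connected (\<Union>K - V)"
    using connected_minus_finite[OF connected half_discs \<open>finite V\<close>] .
  ultimately have "body A \<inter> (\<Union>K - V) = {} \<or> body B \<inter> (\<Union>K - V) = {}"
    using closed[OF A(1)] closed[OF B(2)] by (intro connected_closedD) blast+
  then show False using meets[OF A] meets[OF B(2,1)] by blast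
qed

lemma triangle_across_edge:
  assumes v: "disc_point (\<Union>K) v" and C: "C \<in> triangles" "v \<in> C" "w \<in> C"
  obtains D where "D \<in> triangles" "D \<noteq> C" "v \<in> D" "w \<in> D"
proof -
  let ?e = "convex hull {v, w}"
  have e: "?e face_of convex hull C"
    unfolding face_of_convex_hull_affine_independent[OF trianglesD(1)[OF C(1)]]
    using C by (intro exI[of _ "{v, w}"]) simp
  have "card {v, w} \<le> 2" by (simp add: card_insert_if)
  then have "aff_dim ?e \<le> 1"
    using aff_dim_le_card[of "{v, w}"] by (simp add: aff_dim_convex_hull)
  moreover have "aff_dim (convex hull C) = 2"
    using aff_dim_affine_independent[OF trianglesD(1)[OF C(1)]] trianglesD(2)[OF C(1)]
    by (simp add: aff_dim_convex_hull)
  ultimately have "?e \<noteq> convex hull C" by auto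
  have "v \<in> ?e" by (simp add: hull_inc)
  obtain \<sigma> where \<sigma>: "\<sigma> \<in> K" "aff_dim \<sigma> = 2" "?e \<subseteq> \<sigma>" "\<sigma> \<noteq> convex hull C"
    by (rule second_triangle[OF v \<open>v \<in> ?e\<close> e \<open>?e \<noteq> convex hull C\<close> trianglesD(4)[OF C(1)]])
  obtain D where D: "D \<in> triangles" "\<sigma> = convex hull D" by (rule triangle_vertex_set[OF \<sigma>(1,2)])
  have "v \<in> convex hull D" "w \<in> convex hull D" using \<sigma>(3) D hull_subset[of "{v, w}" convex] by auto
  then show thesis using that[of D] D \<sigma>(4) vertex_in_triangle[OF D(1) C(1)] C(2,3) by blast
qed

end

section \<open>Packings as tangency layouts\<close>

text \<open>Otherwise the point that divides the segment of centres in the ratio of the radii lies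
  in both balls.\<close>

lemma disjoint_balls_dist:
  fixes x y :: complex
  assumes "a > 0" "b > 0" "ball x a \<inter> ball y b = {}"
  shows "a + b \<le> dist x y"
proof (rule ccontr)
  assume less: "\<not> a + b \<le> dist x y"
  define z where "z = x + (a / (a + b)) *\<^sub>R (y - x)"
  have "y - z = (b / (a + b)) *\<^sub>R (y - x)"
  proof -
    have "b / (a + b) = 1 - a / (a + b)" using assms(1,2) by (simp add: field_simps)
    then show ?thesis unfolding z_def by (simp only: scaleR_left_diff_distrib scaleR_one) simp
  qed
  then have "dist y z = (b / (a + b)) * dist y x"
    using assms(1,2) by (simp add: dist_norm)
  moreover have "dist z x = (a / (a + b)) * dist y x"
    using assms(1,2) by (simp add: dist_norm z_def)
  moreover have "c / (a + b) * dist y x < c" if "c > 0" for c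
  proof -
    have "dist y x / (a + b) < 1" using less assms(1,2) by (simp add: dist_commute)
    then have "c * (dist y x / (a + b)) < c * 1" using that by (rule mult_strict_left_mono)
    then show ?thesis by simp
  qed
  ultimately have "dist y z < b" "dist z x < a" using assms(1,2) by auto
  then have "z \<in> ball x a \<inter> ball y b" by (simp add: dist_commute)
  then show False using assms(3) by blast
qed

text \<open>Disjointness of the interiors excludes internal tangency.\<close>

lemma tangent_disjoint_dist:
  assumes "tangent C D" "radius C > 0" "radius D > 0"
    and "circle_interior C \<inter> circle_interior D = {}"
  shows "dist (centre C) (centre D) = radius C + radius D"
proof (rule antisym)
  obtain p where "p \<in> sphere (centre C) (radius C)" "p \<in> sphere (centre D) (radius D)"
    using assms(1) unfolding tangent_def circle_points_def by blast
  then show "dist (centre C) (centre D) \<le> radius C + radius D"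
    using dist_triangle2[of "centre C" "centre D" p] by simp
  show "radius C + radius D \<le> dist (centre C) (centre D)"
    using assms(2-) by (intro disjoint_balls_dist) (simp_all add: circle_interior_def)
qed

lemma bordered_surface_complex:
  assumes "bordered_triangulated_surface S K h"
  shows "complex_on_surface K"
proof
  have h: "homeomorphic_map (top_of_set (\<Union>K)) S h" "surface S" "connected_space S" "simplicial_complex K"
    using assms by (auto simp: bordered_triangulated_surface_def)
  show "simplicial_complex K" by fact
  have "connected_space (top_of_set (\<Union>K))"
    using h homeomorphic_connected_space homeomorphic_map_imp_homeomorphic_space by blast
  then show "connected (\<Union>K)" by (simp add: connectedin_def flip: connectedin_iff_connected)
  show "half_disc_point (\<Union>K) x" if "x \<in> \<Union>K" for x using surface_point_half_disc[OF h(2,1) that] .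
qed

context complex_on_surface
begin

lemma triangles_surrounded:
  assumes "disc_point (\<Union>K) v" "v \<in> \<Union>triangles"
  shows "surrounded triangles v"
  unfolding surrounded_def
proof (intro conjI ballI impI)
  show "\<exists>t\<in>triangles. v \<in> t" using assms(2) by blast
  fix C w assume "C \<in> triangles" "v \<in> C" "w \<in> C - {v}"
  then have C: "C \<in> triangles" "v \<in> C" "w \<in> C" by auto
  show "\<exists>t'\<in>triangles. t' \<noteq> C \<and> v \<in> t' \<and> w \<in> t'"
    by (rule triangle_across_edge[OF assms(1) C]) blast
qed

lemma edge_connected_triangles: "edge_connected triangles"
  unfolding edge_connected_def using triangles_edge_connected by blast

lemma triangle_subset: "C \<in> triangles \<Longrightarrow> C \<subseteq> \<Union>K"
  using trianglesD(4) hull_subset[of C convex] by blast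

text \<open>Every vertex of the complex lies on a triangle, so the faces carry all the circles.\<close>

lemma vertices_eq:
  assumes "inj_on h (\<Union>K)"
  shows "triangulation_vertices K h = h ` \<Union>triangles"
proof (intro equalityI subsetI)
  fix v assume "v \<in> triangulation_vertices K h"
  then obtain C where C: "{v} = h ` C" "card C = 1" "convex hull C \<in> K"
    by (auto simp: triangulation_vertices_def triangulation_simplices_def)
  then obtain x where x: "C = {x}" by (auto simp: card_1_singleton_iff)
  then have xK: "{x} \<in> K" and v: "v = h x" using C by auto
  obtain \<sigma> where \<sigma>: "\<sigma> \<in> K" "{x} \<subseteq> \<sigma>" "aff_dim \<sigma> = 2" by (rule in_triangle[OF xK]) auto
  obtain D where D: "D \<in> triangles" "\<sigma> = convex hull D" by (rule triangle_vertex_set[OF \<sigma>(1,3)])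
  have "\<sigma> \<inter> {x} face_of \<sigma>" using Int_face \<sigma>(1) xK by blast
  moreover have "\<sigma> \<inter> {x} = {x}" using \<sigma>(2) by blast
  ultimately have "x \<in> D"
    using extreme_point_of_convex_hull_affine_independent[OF trianglesD(1)[OF D(1)]] D(2)
    by (simp add: face_of_singleton)
  then show "v \<in> h ` \<Union>triangles" using v D by blast
next
  fix v assume "v \<in> h ` \<Union>triangles"
  then obtain C x where C: "C \<in> triangles" "x \<in> C" "v = h x" by blast
  have "{x} face_of convex hull C"
    using extreme_point_of_convex_hull_affine_independent[OF trianglesD(1)[OF C(1)]] C(2)
    by (simp add: face_of_singleton)
  then have "{x} \<in> K" using face_in_K trianglesD(4)[OF C(1)] by blast
  then show "v \<in> triangulation_vertices K h"
    using C(3) unfolding triangulation_vertices_def triangulation_simplices_def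
    by (auto intro!: exI[of _ "{x}"])
qed

lemma packing_layout:
  assumes inj: "inj_on h (\<Union>K)" and P: "triangle_type_packing K h P \<phi>"
  shows "tangency_layout triangles (centre \<circ> \<phi> \<circ> h) (radius \<circ> \<phi> \<circ> h)"
proof
  have iso: "graph_isomorphism (nerve K h) (contact_graph P) \<phi>" and pack: "planar_circle_packing P"
    and faces: "faces_do_not_overlap K h \<phi>"
    using P by (auto simp: triangle_type_packing_def)
  have bij: "bij_betw \<phi> (triangulation_vertices K h) P"
    using iso by (simp add: graph_isomorphism_def nerve_def contact_graph_def)
  have vert: "h a \<in> triangulation_vertices K h" if "t \<in> triangles" "a \<in> t" for t a
    using that vertices_eq[OF inj] by blast
  have inP: "\<phi> (h a) \<in> P" if "t \<in> triangles" "a \<in> t" for t a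
    using vert[OF that] bij by (auto simp: bij_betw_def)
  show "finite triangles" by (rule finite_triangles)
  show "card t = 3" if "t \<in> triangles" for t using trianglesD(2)[OF that] .
  show pos: "0 < (radius \<circ> \<phi> \<circ> h) a" if "t \<in> triangles" "a \<in> t" for t a
    using inP[OF that] pack by (auto simp: planar_circle_packing_def)
  show "dist ((centre \<circ> \<phi> \<circ> h) a) ((centre \<circ> \<phi> \<circ> h) b) = (radius \<circ> \<phi> \<circ> h) a + (radius \<circ> \<phi> \<circ> h) b"
    if t: "t \<in> triangles" "a \<in> t" "b \<in> t" "a \<noteq> b" for t a b
  proof -
    have "h a \<noteq> h b" using inj t triangle_subset by (metis inj_onD subsetD)
    then have ne: "\<phi> (h a) \<noteq> \<phi> (h b)" using bij vert t by (metis bij_betw_imp_inj_on inj_onD)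
    have "convex hull {a, b} face_of convex hull t"
      unfolding face_of_convex_hull_affine_independent[OF trianglesD(1)[OF t(1)]]
      using t by (intro exI[of _ "{a, b}"]) simp
    then have "convex hull {a, b} \<in> K" using face_in_K trianglesD(4)[OF t(1)] by blast
    moreover have "\<not> affine_dependent {a, b}" "card {a, b} = 1 + 1" using t(4) by auto
    ultimately have "h ` {a, b} \<in> triangulation_simplices 1 K h"
      unfolding triangulation_simplices_def by blast
    then have "{h a, h b} \<in> snd (nerve K h)" by (simp add: nerve_def)
    then have "{\<phi> (h a), \<phi> (h b)} \<in> snd (contact_graph P)"
      using iso vert t by (auto simp: graph_isomorphism_def nerve_def)
    then obtain C D where "{\<phi> (h a), \<phi> (h b)} = {C, D}" "tangent C D"
      by (auto simp: contact_graph_def)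
    then have "tangent (\<phi> (h a)) (\<phi> (h b))"
      by (auto simp: doubleton_eq_iff tangent_def Int_commute)
    then show ?thesis
      using tangent_disjoint_dist pos[OF t(1,2)] pos[OF t(1,3)] inP[OF t(1,2)] inP[OF t(1,3)] ne pack
      by (simp add: planar_circle_packing_def)
  qed
  show "interior (convex hull (centre \<circ> \<phi> \<circ> h) ` t) \<inter> interior (convex hull (centre \<circ> \<phi> \<circ> h) ` t') = {}"
    if t: "t \<in> triangles" "t' \<in> triangles" "t \<noteq> t'" for t t'
  proof -
    have "h ` t \<in> triangulation_simplices 2 K h" "h ` t' \<in> triangulation_simplices 2 K h"
      using t unfolding triangulation_simplices_def triangles_def by auto
    moreover have "h ` t \<noteq> h ` t'"
      using inj_on_image_eq_iff[OF inj triangle_subset triangle_subset] t by blast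
    ultimately have "interior (convex hull (centre \<circ> \<phi>) ` h ` t) \<inter>
        interior (convex hull (centre \<circ> \<phi>) ` h ` t') = {}"
      using faces unfolding faces_do_not_overlap_def by blast
    then show ?thesis by (simp only: image_comp)
  qed
qed

end

theorem corollary1p11:
  fixes S :: "'a topology"
    and K :: "'n::euclidean_space set set"
    and h :: "'n \<Rightarrow> 'a"
    and P1 P2 :: "circle set"
    and \<phi>1 \<phi>2 :: "'a \<Rightarrow> circle"
  assumes "bordered_triangulated_surface S K h"
    and "triangle_type_packing K h P1 \<phi>1"
    and "triangle_type_packing K h P2 \<phi>2"
    and "\<forall>v\<in>boundary_vertices S K h. radius (\<phi>1 v) = radius (\<phi>2 v)"
  shows "\<exists>g :: complex \<Rightarrow> complex.
           bij g \<and> (\<forall>x y. dist (g x) (g y) = dist x y) \<and>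
           (\<forall>v\<in>triangulation_vertices K h. g ` circle_points (\<phi>1 v) = circle_points (\<phi>2 v))"
proof -
  interpret complex_on_surface K by (rule bordered_surface_complex[OF assms(1)])
  have h: "homeomorphic_map (top_of_set (\<Union>K)) S h" and S: "surface S"
    using assms(1) by (auto simp: bordered_triangulated_surface_def)
  have inj: "inj_on h (\<Union>K)" using homeomorphic_imp_injective_map[OF h] by simp
  let ?r1 = "radius \<circ> \<phi>1 \<circ> h" and ?r2 = "radius \<circ> \<phi>2 \<circ> h"
  let ?p1 = "centre \<circ> \<phi>1 \<circ> h" and ?p2 = "centre \<circ> \<phi>2 \<circ> h"
  note L1 = packing_layout[OF inj assms(2)] and L2 = packing_layout[OF inj assms(3)]
  have outer: "?r1 v = ?r2 v" if v: "v \<in> \<Union>triangles" and ns: "\<not> surrounded triangles v" for v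
  proof -
    have vK: "v \<in> \<Union>K" using v triangle_subset by blast
    have "h v \<in> surface_boundary S"
      using inner_point_disc[OF S h vK] triangles_surrounded v ns by blast
    moreover have "h v \<in> triangulation_vertices K h" using vertices_eq[OF inj] v by blast
    ultimately show ?thesis using assms(4) by (simp add: boundary_vertices_def)
  qed
  have radii: "?r1 v = ?r2 v" if "v \<in> \<Union>triangles" for v
  proof (rule antisym)
    show "?r1 v \<le> ?r2 v"
      by (rule radius_maximum_principle[OF L1 L2 eq_refl[OF outer] that])
    show "?r2 v \<le> ?r1 v"
      by (rule radius_maximum_principle[OF L2 L1 eq_refl[OF outer[symmetric]] that])
  qed
  obtain g where g: "rigid_motion g" "\<forall>v\<in>\<Union>triangles. g (?p1 v) = ?p2 v"
    by (rule layout_determined_by_radii[OF L1 L2 radii edge_connected_triangles])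
  note iso = rigid_motion_isometry(1)[OF g(1)] and bij = rigid_motion_isometry(2)[OF g(1)]
  have sphere: "g ` sphere c r = sphere (g c) r" for c r
  proof
    show "g ` sphere c r \<subseteq> sphere (g c) r" using iso by auto
    show "sphere (g c) r \<subseteq> g ` sphere c r"
    proof
      fix y assume y: "y \<in> sphere (g c) r"
      obtain x where "y = g x" using bij by (metis bij_pointE)
      then show "y \<in> g ` sphere c r" using y iso by auto
    qed
  qed
  have "g ` circle_points (\<phi>1 v) = circle_points (\<phi>2 v)" if v: "v \<in> triangulation_vertices K h" for v
  proof -
    obtain x where x: "x \<in> \<Union>triangles" "v = h x" using v vertices_eq[OF inj] by blast
    then show ?thesis using bspec[OF g(2) x(1)] radii[OF x(1)] sphere by (simp add: circle_points_def)
  qed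
  then show ?thesis using bij iso by blast
qed

end
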